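(* For every integer $k\ge 1$, the integer $a_{k+\frac12}=\sum_\mu a_{k+\frac12}(\mu)$ (sum over all integer partitions $\mu$) is the number of type $B$ set partitions of the set $[-k]\cup[k]$.
   Context: $[k]=\{1,\dots,k\}$ and $[-k]=\{-k,\dots,-2,-1\}$. Integer partitions are identified with their Young diagrams and ordered by containment; $\emptyset$ is the only partition of $0$. A limiting vacillating tableau of shape $\mu$ and length $2k+1$ is a sequence of $2k+2$ integer partitions $(\mu^{(0)}=\emptyset,\mu^{(1/2)},\mu^{(1)},\dots,\mu^{(k)},\mu^{(k+1/2)}=\mu)$ such that (a) for each integer $j=0,\dots,k$: $\mu^{(j)}\supseteq\mu^{(j+1/2)}$ and $|\mu^{(j)}/\mu^{(j+1/2)}|\in\{0,1\}$; (b) for each integer $j=0,\dots,k-1$: $\mu^{(j+1/2)}\subseteq\mu^{(j+1)}$ and $|\mu^{(j+1)}/\mu^{(j+1/2)}|=1$. $a_{k+\frac12}(\mu)$ is the number of limiting vacillating tableaux of shape $\mu$ and length $2k+1$. A set partition of type $B$ is a set partition $\pi$ of $[-k]\cup[k]$ such that (a) for any block $X$ of $\pi$, its opposite $-X=\{-x:x\in X\}$ is also a block of $\pi$; and (b) there is at most one zero-block, i.e. at most one block $X$ with $X=-X$. *)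

theory Defs
  imports Main "HOL-Library.Disjoint_Sets"
begin

definition int_partition :: "nat list \<Rightarrow> bool" where
  "int_partition \<mu> \<longleftrightarrow> sorted_wrt (\<ge>) \<mu> \<and> 0 \<notin> set \<mu>"

definition diagram :: "nat list \<Rightarrow> (nat \<times> nat) set" where
  "diagram \<mu> = {(i, j). i < length \<mu> \<and> j < \<mu> ! i}"

text \<open>Half-integer indices are doubled: the entry at position \<open>m\<close> of the list \<open>T\<close> is
  \<open>\<mu>\<close> with superscript \<open>m/2\<close>, so \<open>2 * j\<close> stands for \<open>j\<close> and \<open>2 * j + 1\<close> for \<open>j + 1/2\<close>.\<close>

definition limiting_vacillating_tableau :: "nat \<Rightarrow> nat list \<Rightarrow> nat list list \<Rightarrow> bool" where
  "limiting_vacillating_tableau k \<mu> T \<longleftrightarrow>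
     length T = 2 * k + 2 \<and> (\<forall>\<nu> \<in> set T. int_partition \<nu>) \<and>
     T ! 0 = [] \<and> T ! (2 * k + 1) = \<mu> \<and>
     (\<forall>j \<le> k. diagram (T ! (2 * j + 1)) \<subseteq> diagram (T ! (2 * j)) \<and>
        card (diagram (T ! (2 * j)) - diagram (T ! (2 * j + 1))) \<in> {0, 1}) \<and>
     (\<forall>j < k. diagram (T ! (2 * j + 1)) \<subseteq> diagram (T ! (2 * j + 2)) \<and>
        card (diagram (T ! (2 * j + 2)) - diagram (T ! (2 * j + 1))) = 1)"

definition num_tableaux_of_shape :: "nat \<Rightarrow> nat list \<Rightarrow> nat" where
  "num_tableaux_of_shape k \<mu> = card {T. limiting_vacillating_tableau k \<mu> T}"

text \<open>The sum over all integer partitions has finite support, and each summand counts a finite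
  set; both facts are proved below.\<close>

definition num_tableaux :: "nat \<Rightarrow> nat" where
  "num_tableaux k =
     (\<Sum>\<mu> | int_partition \<mu> \<and> num_tableaux_of_shape k \<mu> \<noteq> 0. num_tableaux_of_shape k \<mu>)"

definition type_B_set_partition :: "nat \<Rightarrow> int set set \<Rightarrow> bool" where
  "type_B_set_partition k P \<longleftrightarrow>
     partition_on ({- int k..-1} \<union> {1..int k}) P \<and>
     (\<forall>X \<in> P. uminus ` X \<in> P) \<and>
     (\<forall>X \<in> P. \<forall>Y \<in> P. uminus ` X = X \<and> uminus ` Y = Y \<longrightarrow> X = Y)"

lemma diagram_eq_Sigma: "diagram \<mu> = Sigma {..<length \<mu>} (\<lambda>i. {..<\<mu> ! i})"
  by (auto simp: diagram_def)

lemma finite_diagram [simp]: "finite (diagram \<mu>)"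
  by (auto simp: diagram_eq_Sigma)

lemma card_diagram: "card (diagram \<mu>) = sum_list \<mu>"
  by (simp add: diagram_eq_Sigma sum_list_sum_nth atLeast0LessThan)

lemma finite_bounded_int_partitions: "finite {\<mu>. int_partition \<mu> \<and> sum_list \<mu> \<le> n}"
proof (rule finite_subset)
  have "length \<mu> \<le> sum_list \<mu>" if "0 \<notin> set \<mu>" for \<mu> :: "nat list"
    using that by (induction \<mu>) auto
  then show "{\<mu>. int_partition \<mu> \<and> sum_list \<mu> \<le> n} \<subseteq> {\<mu>. set \<mu> \<subseteq> {..n} \<and> length \<mu> \<le> n}"
    by (force simp: int_partition_def dest: member_le_sum_list)
  show "finite {\<mu>. set \<mu> \<subseteq> {..n} \<and> length \<mu> \<le> n}"
    by (rule finite_lists_length_le) simp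
qed

lemma tableau_sum_list_le:
  assumes "limiting_vacillating_tableau k \<mu> T" "j \<le> k"
  shows "sum_list (T ! (2 * j)) \<le> j \<and> sum_list (T ! (2 * j + 1)) \<le> j"
  using assms(2)
proof (induction j)
  case 0
  have "T ! 0 = []" and "diagram (T ! (2 * 0 + 1)) \<subseteq> diagram (T ! (2 * 0))"
    using assms(1) unfolding limiting_vacillating_tableau_def by blast+
  then have "diagram (T ! 1) \<subseteq> diagram (T ! 0)" by simp
  then have "sum_list (T ! 1) \<le> sum_list (T ! 0)"
    by (metis card_diagram card_mono finite_diagram)
  then show ?case using \<open>T ! 0 = []\<close> by simp
next
  case (Suc j)
  let ?A = "diagram (T ! (2 * j + 1))" and ?B = "diagram (T ! (2 * j + 2))"
  let ?C = "diagram (T ! (2 * j + 3))"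
  from Suc.prems have j: "j < k" by simp
  have AB: "?A \<subseteq> ?B" "card (?B - ?A) = 1"
    using assms(1) j unfolding limiting_vacillating_tableau_def by blast+
  have "diagram (T ! (2 * Suc j + 1)) \<subseteq> diagram (T ! (2 * Suc j))"
    using assms(1) Suc.prems unfolding limiting_vacillating_tableau_def by blast
  then have CB: "?C \<subseteq> ?B" by (simp add: numeral_3_eq_3)
  have "card ?B = card ?A + 1"
    using AB by (metis card_Diff_subset card_mono finite_diagram le_add_diff_inverse)
  moreover have "card ?A \<le> j" using Suc by (simp add: card_diagram)
  moreover have "card ?C \<le> card ?B" using CB by (simp add: card_mono)
  ultimately show ?case by (simp add: card_diagram numeral_3_eq_3)
qed

lemma finite_all_tableaux: "finite {T. \<exists>\<mu>. limiting_vacillating_tableau k \<mu> T}"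
proof (rule finite_subset)
  let ?S = "{\<mu>. int_partition \<mu> \<and> sum_list \<mu> \<le> k}"
  show "{T. \<exists>\<mu>. limiting_vacillating_tableau k \<mu> T} \<subseteq> {T. set T \<subseteq> ?S \<and> length T = 2 * k + 2}"
  proof safe
    fix T \<mu> \<nu> assume T: "limiting_vacillating_tableau k \<mu> T"
    then show "length T = 2 * k + 2" by (simp add: limiting_vacillating_tableau_def)
    assume \<nu>: "\<nu> \<in> set T"
    with T show "int_partition \<nu>" by (simp add: limiting_vacillating_tableau_def)
    from \<nu> obtain m where m: "m < 2 * k + 2" "T ! m = \<nu>"
      using T by (auto simp: in_set_conv_nth limiting_vacillating_tableau_def)
    define j where "j = m div 2"
    have "m = 2 * j \<or> m = 2 * j + 1" "j \<le> k" using m(1) by (auto simp: j_def)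
    then show "sum_list \<nu> \<le> k"
      using tableau_sum_list_le[OF T, of j] m(2) by auto
  qed
  show "finite {T. set T \<subseteq> ?S \<and> length T = 2 * k + 2}"
    by (rule finite_lists_length_eq) (rule finite_bounded_int_partitions)
qed

lemma finite_tableaux_of_shape: "finite {T. limiting_vacillating_tableau k \<mu> T}"
  by (rule finite_subset[OF _ finite_all_tableaux[of k]]) auto

lemma finite_tableaux_support: "finite {\<mu>. int_partition \<mu> \<and> num_tableaux_of_shape k \<mu> \<noteq> 0}"
proof (rule finite_subset)
  show "{\<mu>. int_partition \<mu> \<and> num_tableaux_of_shape k \<mu> \<noteq> 0} \<subseteq>
    (\<lambda>T. T ! (2 * k + 1)) ` {T. \<exists>\<mu>. limiting_vacillating_tableau k \<mu> T}"
  proof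
    fix \<mu> assume "\<mu> \<in> {\<mu>. int_partition \<mu> \<and> num_tableaux_of_shape k \<mu> \<noteq> 0}"
    then have "num_tableaux_of_shape k \<mu> \<noteq> 0" by simp
    then have "{T. limiting_vacillating_tableau k \<mu> T} \<noteq> {}"
      unfolding num_tableaux_of_shape_def by (metis card.empty)
    then obtain T where T: "limiting_vacillating_tableau k \<mu> T" by blast
    then have "\<mu> = T ! (2 * k + 1)" by (simp add: limiting_vacillating_tableau_def)
    with T show "\<mu> \<in> (\<lambda>T. T ! (2 * k + 1)) ` {T. \<exists>\<mu>. limiting_vacillating_tableau k \<mu> T}"
      by blast
  qed
qed (simp add: finite_all_tableaux)

end

theory Submission
  imports Defs "HOL-Combinatorics.Stirling"
begin

text \<open>
  Both sides are equal to \<open>\<Sum>n\<le>k. S(k+1, n+1) * I(n)\<close>, where \<open>S\<close> are the Stirling numbers of the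
  second kind and \<open>I(n)\<close> is the number of involutions of \<open>n\<close> points.

  \<^bold>\<open>Tableaux.\<close> Let \<open>U\<close> and \<open>D\<close> add and remove a corner of a Young diagram. A diagram has one more
  addable than removable corner, and adding one corner commutes with removing another one, so
  \<open>D U = U D + 1\<close> (\<open>sum_add_then_remove\<close>). Let \<open>f(\<mu>)\<close> be the number of standard Young tableaux of shape
  \<open>\<mu>\<close>, that is, the coefficient of \<open>\<mu>\<close> in the power of \<open>U\<close> with exponent \<open>|\<mu>|\<close> applied to the empty
  diagram. The commutation relation shows that \<open>D\<close> acts on powers of \<open>U\<close> like differentiation
  (\<open>sum_num_SYT_addable\<close>), so \<open>U (1 + D)\<close> maps the \<open>n\<close>th power of \<open>U\<close> to the \<open>(n+1)\<close>st power plus \<open>n\<close>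
  times the \<open>n\<close>th. This is the recurrence of the Stirling numbers, and the number of limiting
  vacillating tableaux of shape \<open>\<mu>\<close> is therefore \<open>S(k+1, |\<mu>|+1) * f(\<mu>)\<close>
  (\<open>num_tableaux_of_shape_eq\<close>). The same relation shows that the sum of \<open>f(\<mu>)\<close> over all \<open>\<mu>\<close> of
  size \<open>n\<close> satisfies \<open>I(n+2) = I(n+1) + (n+1) I(n)\<close> (\<open>sum_num_SYT\<close>).

  \<^bold>\<open>Set partitions.\<close> The intersections of the blocks of a type \<open>B\<close> partition with \<open>{1..k}\<close> partition
  \<open>{1..k}\<close>. Mark the positive part of the zero-block by adding \<open>0\<close> to it, or add the block \<open>{0}\<close> if
  there is no zero-block; this gives a partition of \<open>{0..k}\<close> into \<open>n + 1\<close> blocks. The \<open>n\<close> blocks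
  without \<open>0\<close> carry an involution, which fixes \<open>A\<close> if \<open>A\<close> itself is a block and swaps \<open>A\<close> and
  \<open>B\<close> if \<open>A \<union> -B\<close> is a block. Hence \<open>S(k+1, n+1) * I(n)\<close> type \<open>B\<close> partitions belong to \<open>n\<close>, and
  an involution with \<open>m\<close> cycles belongs to \<open>2 m\<close> nonzero blocks. The formal argument keeps track of the
  number \<open>q\<close> of nonzero blocks and compares recurrences. The elements \<open>k+1\<close> and \<open>-(k+1)\<close> are
  inserted as two singleton blocks, or both into the zero-block, or into one of the \<open>q\<close> nonzero blocks
  and its opposite (\<open>sum_signed_partitions_insert\<close>). On the other side, \<open>q = 2 m\<close> is \<open>n\<close> plus the
  number of fixed points of the involution, and the terms with a fixed point are counted by deleting
  it (\<open>involution_sum_double_cycles\<close>).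
\<close>

section \<open>Young diagrams and their corners\<close>

definition young :: "(nat \<times> nat) set \<Rightarrow> bool" where
  "young D \<longleftrightarrow> finite D \<and> (\<forall>i j i' j'. (i, j) \<in> D \<longrightarrow> i' \<le> i \<longrightarrow> j' \<le> j \<longrightarrow> (i', j') \<in> D)"

definition addable :: "(nat \<times> nat) set \<Rightarrow> (nat \<times> nat) set" where
  "addable D = {p. p \<notin> D \<and> young (insert p D)}"

definition removable :: "(nat \<times> nat) set \<Rightarrow> (nat \<times> nat) set" where
  "removable D = {p \<in> D. young (D - {p})}"

lemma young_finite: "young D \<Longrightarrow> finite D"
  by (simp add: young_def)

lemma young_downward: "young D \<Longrightarrow> (i, j) \<in> D \<Longrightarrow> i' \<le> i \<Longrightarrow> j' \<le> j \<Longrightarrow> (i', j') \<in> D"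
  unfolding young_def by blast

lemma young_Un: "young D \<Longrightarrow> young E \<Longrightarrow> young (D \<union> E)"
  unfolding young_def by blast

lemma young_Int: "young D \<Longrightarrow> young E \<Longrightarrow> young (D \<inter> E)"
  unfolding young_def by blast

text \<open>Row lengths turn statements about corners into statements about descents of a sequence.\<close>
lemma young_rows:
  assumes "young D"
  obtains r where "antimono r" "D = {(i, j). j < r i}" "finite {i. 0 < r i}"
proof -
  define r where "r i = (LEAST j. (i, j) \<notin> D)" for i
  have out: "(i, r i) \<notin> D" for i
  proof -
    have "finite {j. (i, j) \<in> D}"
      using young_finite[OF assms] by (rule finite_subset[rotated, OF finite_imageI[of _ snd]]) force
    then have "\<exists>j. (i, j) \<notin> D"
      using infinite_UNIV_nat by (metis UNIV_eq_I mem_Collect_eq)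
    then show ?thesis unfolding r_def by (rule LeastI_ex)
  qed
  have iff: "(i, j) \<in> D \<longleftrightarrow> j < r i" for i j
  proof
    assume "(i, j) \<in> D"
    show "j < r i"
    proof (rule ccontr)
      assume "\<not> j < r i"
      then have "(i, r i) \<in> D"
        using assms \<open>(i, j) \<in> D\<close> unfolding young_def by (meson le_refl not_less)
      then show False using out by blast
    qed
  next
    assume "j < r i"
    then show "(i, j) \<in> D" unfolding r_def using not_less_Least by blast
  qed
  have "antimono r"
  proof (rule antimonoI)
    fix i i' :: nat assume "i \<le> i'"
    then have "(i', r i) \<notin> D"
      using out[of i] assms unfolding young_def by blast
    then show "r i' \<le> r i" by (simp add: iff)
  qed
  moreover have "finite {i. 0 < r i}"
    using young_finite[OF assms]
    by (rule finite_subset[rotated, OF finite_imageI[of _ fst]]) (force simp: iff[symmetric])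
  ultimately show thesis using that iff by blast
qed

lemma young_of_rows:
  assumes "antimono r" "finite {i. 0 < r i}"
  shows "young {(i, j). j < (r i :: nat)}"
  unfolding young_def
proof (intro conjI allI impI)
  have "{(i, j). j < r i} = Sigma {i. 0 < r i} (\<lambda>i. {..<r i})" by auto
  then show "finite {(i, j). j < r i}" using assms(2) by simp
  fix i j i' j' assume "(i, j) \<in> {(i, j). j < r i}" "i' \<le> i" "j' \<le> j"
  then show "(i', j') \<in> {(i, j). j < r i}"
    using antimonoD[OF assms(1), of i' i] by simp
qed

text \<open>A corner can be removed from row \<open>i\<close> exactly if row \<open>i + 1\<close> is strictly shorter, and this is
  also the condition for adding a corner to row \<open>i + 1\<close>. A corner can always be added to row \<open>0\<close>,
  which accounts for the difference of one.\<close>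
lemma finite_card_addable:
  assumes "young D"
  shows "finite (addable D)" and "card (addable D) = Suc (card (removable D))"
proof -
  obtain r where r: "antimono r" "D = {(i, j). j < r i}" "finite {i. 0 < r i}"
    using young_rows[OF assms] .
  \<comment> \<open>The rows that end in a removable corner.\<close>
  define C where "C = {i. r (Suc i) < r i}"
  have finC: "finite C" by (rule finite_subset[OF _ r(3)]) (auto simp: C_def)
  have rem: "removable D = (\<lambda>i. (i, r i - 1)) ` C"
  proof (intro equalityI subsetI)
    fix p assume p: "p \<in> removable D"
    obtain i j where ij: "p = (i, j)" by (cases p)
    from p ij have j: "j < r i" and y: "young (D - {(i, j)})" by (auto simp: removable_def r)
    have "\<not> Suc j < r i"
      using young_downward[OF y, of i "Suc j" i j] by (auto simp: r)
    moreover have "\<not> j < r (Suc i)"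
      using young_downward[OF y, of "Suc i" j i j] by (auto simp: r)
    ultimately show "p \<in> (\<lambda>i. (i, r i - 1)) ` C" using j ij by (force simp: C_def)
  next
    fix p assume "p \<in> (\<lambda>i. (i, r i - 1)) ` C"
    then obtain i where i: "r (Suc i) < r i" "p = (i, r i - 1)" by (auto simp: C_def)
    have eq: "D - {p} = {(a, b). b < (r(i := r i - 1)) a}"
      using i by (auto simp: r split: if_splits)
    have "antimono (r(i := r i - 1))"
    proof (rule antimonoI)
      fix a b :: nat assume "a \<le> b"
      then show "(r(i := r i - 1)) b \<le> (r(i := r i - 1)) a"
        using antimonoD[OF r(1), of a b] antimonoD[OF r(1), of "Suc i" b] i(1) by auto
    qed
    moreover have "finite {a. 0 < (r(i := r i - 1)) a}"
      by (rule finite_subset[OF _ r(3)]) (auto split: if_splits)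
    ultimately have "young (D - {p})" unfolding eq by (rule young_of_rows)
    then show "p \<in> removable D" using i by (simp add: removable_def r)
  qed
  have add: "addable D = (\<lambda>i. (i, r i)) ` insert 0 (Suc ` C)"
  proof (intro equalityI subsetI)
    fix p assume p: "p \<in> addable D"
    obtain i j where ij: "p = (i, j)" by (cases p)
    from p ij have j: "\<not> j < r i" and y: "young (insert (i, j) D)" by (auto simp: addable_def r)
    have "\<not> r i < j"
      using young_downward[OF y, of i j i "r i"] by (auto simp: r)
    with j have j_eq: "j = r i" by simp
    have "i = 0 \<or> (\<exists>a. i = Suc a \<and> a \<in> C)"
    proof (cases i)
      case (Suc a)
      have "(a, j) \<in> insert (i, j) D"
        using young_downward[OF y, of i j a j] Suc by simp
      then show ?thesis using Suc j_eq by (auto simp: r C_def)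
    qed simp
    then show "p \<in> (\<lambda>i. (i, r i)) ` insert 0 (Suc ` C)" using ij j_eq by auto
  next
    fix p assume "p \<in> (\<lambda>i. (i, r i)) ` insert 0 (Suc ` C)"
    then obtain i where i: "p = (i, r i)" "\<And>a. i = Suc a \<Longrightarrow> r i < r a" by (auto simp: C_def)
    have eq: "insert p D = {(a, b). b < (r(i := Suc (r i))) a}"
      using i by (auto simp: r split: if_splits)
    have "antimono (r(i := Suc (r i)))"
    proof (rule antimonoI)
      fix a b :: nat assume "a \<le> b"
      moreover have "Suc (r i) \<le> r a" if "a < i"
        using i(2)[of "i - 1"] antimonoD[OF r(1), of a "i - 1"] that by (cases i) auto
      ultimately show "(r(i := Suc (r i))) b \<le> (r(i := Suc (r i))) a"
        using antimonoD[OF r(1), of a b] by auto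
    qed
    moreover have "finite {a. 0 < (r(i := Suc (r i))) a}"
      by (rule finite_subset[of _ "insert i {i. 0 < r i}"]) (use r(3) in \<open>auto split: if_splits\<close>)
    ultimately have "young (insert p D)" unfolding eq by (rule young_of_rows)
    then show "p \<in> addable D" using i(1) by (simp add: addable_def r)
  qed
  show "finite (addable D)" using finC by (simp add: add)
  have "card (addable D) = card (insert 0 (Suc ` C))"
    unfolding add by (rule card_image) (auto simp: inj_on_def)
  also have "\<dots> = Suc (card C)" using finC by (simp add: card_image)
  also have "card C = card (removable D)"
    unfolding rem by (rule card_image[symmetric]) (auto simp: inj_on_def)
  finally show "card (addable D) = Suc (card (removable D))" .
qed

lemma finite_removable: "young D \<Longrightarrow> finite (removable D)"
  by (rule finite_subset[of _ D]) (auto simp: removable_def young_finite)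

lemma young_minus_removable: "q \<in> removable D \<Longrightarrow> young (D - {q})"
  by (simp add: removable_def)

lemma young_insert_addable: "p \<in> addable D \<Longrightarrow> young (insert p D)"
  by (simp add: addable_def)

text \<open>Young diagrams are closed under union and intersection. If \<open>D\<close> and \<open>D + p - q\<close> are diagrams, then
  so are their union \<open>D + p\<close> and their intersection \<open>D - q\<close>; hence the order of the two steps is
  irrelevant.\<close>
lemma add_then_remove_iff:
  assumes "young D" "p \<noteq> q"
  shows "p \<in> addable D \<and> q \<in> removable (insert p D) \<longleftrightarrow>
    q \<in> removable D \<and> p \<in> addable (D - {q})" (is "?L \<longleftrightarrow> ?R")
proof
  assume L: ?L
  then have y: "young (insert p D - {q})" and q: "q \<in> D" and p: "p \<notin> D"
    using assms by (auto simp: addable_def removable_def)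
  have "D \<inter> (insert p D - {q}) = D - {q}" using p by auto
  then have "young (D - {q})" using young_Int[OF assms(1) y] by simp
  moreover have "insert p (D - {q}) = insert p D - {q}" using assms(2) by auto
  ultimately show ?R using y p q by (simp add: addable_def removable_def)
next
  assume R: ?R
  then have y: "young (insert p (D - {q}))" and q: "q \<in> D" and p: "p \<notin> D"
    using assms by (auto simp: addable_def removable_def)
  have "D \<union> insert p (D - {q}) = insert p D" by auto
  then have "young (insert p D)" using young_Un[OF assms(1) y] by simp
  moreover have "insert p (D - {q}) = insert p D - {q}" using assms(2) by auto
  ultimately show ?L using y p q by (simp add: addable_def removable_def)
qed

text \<open>The commutation relation \<open>D U = U D + 1\<close> of the operators that remove and add a corner, written
  out for a function \<open>F\<close> on diagrams. Pairs of different corners match by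
  \<open>add_then_remove_iff\<close>; adding and removing the same corner returns to \<open>D\<close> in one more way than
  removing and adding it.\<close>
lemma sum_add_then_remove:
  fixes F :: "(nat \<times> nat) set \<Rightarrow> nat"
  assumes y: "young D"
  shows "(\<Sum>p\<in>addable D. \<Sum>q\<in>removable (insert p D). F (insert p D - {q})) =
    F D + (\<Sum>q\<in>removable D. \<Sum>p\<in>addable (D - {q}). F (insert p (D - {q})))"
proof -
  let ?S = "SIGMA p:addable D. removable (insert p D) - {p}"
  let ?S' = "SIGMA q:removable D. addable (D - {q}) - {q}"
  have "(\<Sum>p\<in>addable D. \<Sum>q\<in>removable (insert p D). F (insert p D - {q})) =
    (\<Sum>p\<in>addable D. F D + (\<Sum>q\<in>removable (insert p D) - {p}. F (insert p D - {q})))"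
  proof (rule sum.cong[OF refl])
    fix p assume p: "p \<in> addable D"
    \<comment> \<open>The term \<open>q = p\<close> is split off, as it leads back to \<open>D\<close>.\<close>
    then have "p \<in> removable (insert p D)" "insert p D - {p} = D"
      using y by (auto simp: addable_def removable_def)
    then show "(\<Sum>q\<in>removable (insert p D). F (insert p D - {q})) =
      F D + (\<Sum>q\<in>removable (insert p D) - {p}. F (insert p D - {q}))"
      using sum.remove[OF finite_removable[OF young_insert_addable[OF p]],
          of p "\<lambda>q. F (insert p D - {q})"] by simp
  qed
  also have "\<dots> = card (addable D) * F D + (\<Sum>(p, q)\<in>?S. F (insert p D - {q}))"
    using finite_card_addable(1)[OF y]
    by (simp add: sum.distrib sum.Sigma finite_removable young_insert_addable)
  also have "(\<Sum>(p, q)\<in>?S. F (insert p D - {q})) = (\<Sum>(q, p)\<in>?S'. F (insert p (D - {q})))"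
  proof (rule sum.reindex_bij_witness[of _ prod.swap prod.swap])
    have swap: "(p, q) \<in> ?S \<longleftrightarrow> (q, p) \<in> ?S'" for p q
      using add_then_remove_iff[OF y, of p q] by (cases "p = q") auto
    show "prod.swap x \<in> ?S'" if "x \<in> ?S" for x
      using swap[of "fst x" "snd x"] that by (simp add: prod.swap_def)
    show "prod.swap x \<in> ?S" if "x \<in> ?S'" for x
      using swap[of "snd x" "fst x"] that by (simp add: prod.swap_def)
    show "(case prod.swap x of (q, p) \<Rightarrow> F (insert p (D - {q}))) =
      (case x of (p, q) \<Rightarrow> F (insert p D - {q}))" if "x \<in> ?S" for x
    proof -
      have "insert (fst x) D - {snd x} = insert (fst x) (D - {snd x})" using that by auto
      then show ?thesis by (simp add: split_beta)
    qed
  qed simp_all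
  also have "card (addable D) * F D + \<dots> =
    F D + (\<Sum>q\<in>removable D. F D + (\<Sum>p\<in>addable (D - {q}) - {q}. F (insert p (D - {q}))))"
    using finite_card_addable[OF y] finite_removable[OF y]
    by (simp add: sum.distrib sum.Sigma young_minus_removable finite_card_addable(1))
  also have "(\<Sum>q\<in>removable D. F D + (\<Sum>p\<in>addable (D - {q}) - {q}. F (insert p (D - {q})))) =
    (\<Sum>q\<in>removable D. \<Sum>p\<in>addable (D - {q}). F (insert p (D - {q})))"
  proof (rule sum.cong[OF refl])
    fix q assume q: "q \<in> removable D"
    then have "q \<in> addable (D - {q})" "insert q (D - {q}) = D"
      using y by (auto simp: addable_def removable_def insert_absorb)
    then show "F D + (\<Sum>p\<in>addable (D - {q}) - {q}. F (insert p (D - {q}))) =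
      (\<Sum>p\<in>addable (D - {q}). F (insert p (D - {q})))"
      using sum.remove[OF finite_card_addable(1)[OF young_minus_removable[OF q]],
          of q "\<lambda>p. F (insert p (D - {q}))"] by simp
  qed
  finally show ?thesis .
qed

section \<open>Integer partitions as Young diagrams\<close>

lemma young_diagram:
  assumes "int_partition \<mu>"
  shows "young (diagram \<mu>)"
proof -
  have "\<mu> ! i \<le> \<mu> ! i'" if "i' \<le> i" "i < length \<mu>" for i i'
    using that assms by (cases "i = i'") (auto simp: int_partition_def sorted_wrt_iff_nth_less)
  then have "(i', j') \<in> diagram \<mu>" if "(i, j) \<in> diagram \<mu>" "i' \<le> i" "j' \<le> j" for i j i' j'
    using that unfolding diagram_def by (simp, meson le_less_trans less_le_trans)
  then show ?thesis unfolding young_def by (meson finite_diagram)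
qed

lemma inj_on_diagram: "inj_on diagram {\<mu>. int_partition \<mu>}"
proof (rule inj_onI, unfold mem_Collect_eq)
  fix \<mu> \<nu> assume pp: "int_partition \<mu>" "int_partition \<nu>" and eq: "diagram \<mu> = diagram \<nu>"
  have len: "length \<rho> = card {i. (i, 0) \<in> diagram \<rho>}" if "int_partition \<rho>" for \<rho>
  proof -
    have "{i. (i, 0) \<in> diagram \<rho>} = {..<length \<rho>}"
      using that by (auto simp: diagram_def int_partition_def intro!: gr0I) (metis nth_mem)
    then show ?thesis by simp
  qed
  have row: "\<rho> ! i = card {j. (i, j) \<in> diagram \<rho>}" if "i < length \<rho>" for \<rho> i
  proof -
    have "{j. (i, j) \<in> diagram \<rho>} = {..<\<rho> ! i}" using that by (auto simp: diagram_def)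
    then show ?thesis by simp
  qed
  show "\<mu> = \<nu>"
    by (rule nth_equalityI) (use len[OF pp(1)] len[OF pp(2)] row eq in auto)
qed

lemma diagram_image: "diagram ` {\<mu>. int_partition \<mu>} = {D. young D}"
proof (intro equalityI subsetI)
  fix D assume "D \<in> {D. young D}"
  then obtain r where r: "antimono r" "D = {(i, j). j < r i}" "finite {i. 0 < r i}"
    using young_rows by blast
  \<comment> \<open>The number of nonempty rows.\<close>
  define n where "n = (LEAST i. r i = 0)"
  have "\<exists>i. r i = 0"
    using r(3) infinite_UNIV_nat by (metis (mono_tags) UNIV_eq_I gr0I mem_Collect_eq)
  then have "r n = 0" unfolding n_def by (rule LeastI_ex)
  have n: "0 < r i \<longleftrightarrow> i < n" for i
  proof
    assume "0 < r i"
    then show "i < n" using antimonoD[OF r(1), of n i] \<open>r n = 0\<close> by (cases "n \<le> i") auto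
  next
    assume "i < n"
    then show "0 < r i" unfolding n_def using not_less_Least by blast
  qed
  have "r j \<le> r i" if "i < j" for i j
    using antimonoD[OF r(1), of i j] that by simp
  moreover have "r i \<noteq> 0" if "i < n" for i
    using n[of i] that by simp
  ultimately have "int_partition (map r [0..<n])"
    unfolding int_partition_def sorted_wrt_iff_nth_less
    by (simp add: image_iff)
  moreover have "diagram (map r [0..<n]) = D"
  proof -
    have "i < n" if "j < r i" for i j
      using n[of i] that by simp
    then show ?thesis by (auto simp: diagram_def r(2))
  qed
  ultimately show "D \<in> diagram ` {\<mu>. int_partition \<mu>}" by blast
qed (auto intro: young_diagram)

lemma sum_over_partitions:
  "(\<Sum>\<mu> | int_partition \<mu> \<and> R (diagram \<mu>). g (diagram \<mu>)) = (\<Sum>D | young D \<and> R D. g D)"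
proof -
  have "inj_on diagram {\<mu>. int_partition \<mu> \<and> R (diagram \<mu>)}"
    by (rule inj_on_subset[OF inj_on_diagram]) auto
  moreover have "diagram ` {\<mu>. int_partition \<mu> \<and> R (diagram \<mu>)} = {D. young D \<and> R D}"
    unfolding Collect_conj_eq diagram_image[symmetric] by auto
  ultimately show ?thesis
    using sum.reindex[of diagram "{\<mu>. int_partition \<mu> \<and> R (diagram \<mu>)}" g] by (simp add: comp_def)
qed

lemma finite_partitions_if_finite_diagrams:
  assumes "finite {D. young D \<and> R D}"
  shows "finite {\<mu>. int_partition \<mu> \<and> R (diagram \<mu>)}"
proof (rule finite_imageD)
  show "finite (diagram ` {\<mu>. int_partition \<mu> \<and> R (diagram \<mu>)})"
    by (rule finite_subset[OF _ assms]) (auto simp: young_diagram)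
  show "inj_on diagram {\<mu>. int_partition \<mu> \<and> R (diagram \<mu>)}"
    by (rule inj_on_subset[OF inj_on_diagram]) auto
qed

lemma finite_young_card: "finite {D. young D \<and> card D = n}"
proof (rule finite_subset)
  show "{D. young D \<and> card D = n} \<subseteq> diagram ` {\<mu>. int_partition \<mu> \<and> sum_list \<mu> \<le> n}"
  proof
    fix D assume "D \<in> {D. young D \<and> card D = n}"
    moreover from this obtain \<mu> where "int_partition \<mu>" "D = diagram \<mu>"
      using diagram_image by blast
    ultimately show "D \<in> diagram ` {\<mu>. int_partition \<mu> \<and> sum_list \<mu> \<le> n}"
      by (auto simp: card_diagram)
  qed
qed (intro finite_imageI finite_bounded_int_partitions)

lemma diagrams_one_cell_larger_or_equal:
  assumes "young D"
  shows "{E. young E \<and> D \<subseteq> E \<and> card (E - D) \<in> {0, 1}} = insert D ((\<lambda>p. insert p D) ` addable D)"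
proof (intro equalityI subsetI)
  fix E assume "E \<in> {E. young E \<and> D \<subseteq> E \<and> card (E - D) \<in> {0, 1}}"
  then have E: "young E" "D \<subseteq> E" "card (E - D) = 0 \<or> card (E - D) = 1" by auto
  from E(3) show "E \<in> insert D ((\<lambda>p. insert p D) ` addable D)"
  proof
    assume "card (E - D) = 0"
    then have "E = D" using E(2) young_finite[OF E(1)] by auto
    then show ?thesis by simp
  next
    assume "card (E - D) = 1"
    then obtain p where "E - D = {p}" by (auto simp: card_1_singleton_iff)
    then have "E = insert p D" "p \<notin> D" using E(2) by auto
    then show ?thesis using E(1) by (auto simp: addable_def)
  qed
next
  fix E assume "E \<in> insert D ((\<lambda>p. insert p D) ` addable D)"
  then show "E \<in> {E. young E \<and> D \<subseteq> E \<and> card (E - D) \<in> {0, 1}}"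
    using assms by (auto simp: addable_def insert_Diff_if)
qed

lemma diagrams_one_cell_smaller:
  "{D. young D \<and> D \<subseteq> E \<and> card (E - D) = 1} = (\<lambda>q. E - {q}) ` removable E"
proof (intro equalityI subsetI)
  fix D assume D: "D \<in> {D. young D \<and> D \<subseteq> E \<and> card (E - D) = 1}"
  then obtain q where "E - D = {q}" by (auto simp: card_1_singleton_iff)
  then have "D = E - {q}" "q \<in> E" using D by auto
  then show "D \<in> (\<lambda>q. E - {q}) ` removable E" using D by (auto simp: removable_def)
next
  fix D assume "D \<in> (\<lambda>q. E - {q}) ` removable E"
  then obtain q where "q \<in> E" "young (E - {q})" "D = E - {q}" by (auto simp: removable_def)
  moreover from this have "E - (E - {q}) = {q}" by auto
  ultimately show "D \<in> {D. young D \<and> D \<subseteq> E \<and> card (E - D) = 1}" by simp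
qed

section \<open>Sums over involutions\<close>

text \<open>The sum of \<open>g\<close> applied to the number of cycles, over all involutions of \<open>n\<close> points. For
  \<open>n + 2\<close> points, the last point is fixed or swapped with one of the \<open>n + 1\<close> other points; deleting
  its cycle leaves an involution of \<open>n + 1\<close> or of \<open>n\<close> points with one cycle less.\<close>
fun involution_sum :: "nat \<Rightarrow> (nat \<Rightarrow> nat) \<Rightarrow> nat" where
  "involution_sum 0 g = g 0"
| "involution_sum (Suc 0) g = g 1"
| "involution_sum (Suc (Suc n)) g =
     involution_sum (Suc n) (\<lambda>m. g (Suc m)) + Suc n * involution_sum n (\<lambda>m. g (Suc m))"

lemma involution_sum_add:
  "involution_sum n (\<lambda>m. g m + h m) = involution_sum n g + involution_sum n h"
  by (induction n arbitrary: g h rule: induct_nat_012) (simp_all add: algebra_simps)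

lemma involution_sum_mult:
  "involution_sum n (\<lambda>m. c * g m) = c * involution_sum n g"
  by (induction n g rule: involution_sum.induct) (auto simp: algebra_simps)

text \<open>An involution of \<open>n\<close> points with \<open>m\<close> cycles has \<open>2 m - n\<close> fixed points. So moving
  \<open>n * involution_sum n g\<close> to the left-hand side gives a count of involutions with a marked fixed point:
  there are \<open>n\<close> choices for this point, and deleting it leaves an involution of \<open>n - 1\<close> points
  with one cycle less.\<close>
lemma involution_sum_double_cycles:
  "involution_sum n (\<lambda>m. 2 * m * g m) =
     n * involution_sum n g + n * involution_sum (n - 1) (\<lambda>m. g (Suc m))"
proof (induction n g rule: involution_sum.induct)
  case (3 n g)
  have split: "involution_sum i (\<lambda>m. 2 * Suc m * g (Suc m)) =
    2 * involution_sum i (\<lambda>m. g (Suc m)) + involution_sum i (\<lambda>m. 2 * m * g (Suc m))" for i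
    unfolding involution_sum_mult[symmetric] involution_sum_add[symmetric]
    by (simp add: algebra_simps)
  have IH1: "involution_sum (Suc n) (\<lambda>m. 2 * m * g (Suc m)) =
      Suc n * involution_sum (Suc n) (\<lambda>m. g (Suc m)) + Suc n * involution_sum n (\<lambda>m. g (Suc (Suc m)))"
    using 3(1) by simp
  have IH2: "involution_sum n (\<lambda>m. 2 * m * g (Suc m)) =
      n * involution_sum n (\<lambda>m. g (Suc m)) + n * involution_sum (n - 1) (\<lambda>m. g (Suc (Suc m)))"
    using 3(2) by simp
  \<comment> \<open>The defining recurrence one step down; the factor \<open>n\<close> makes the truncated \<open>n - 1\<close> harmless.\<close>
  have rec: "involution_sum (Suc n) (\<lambda>m. g (Suc m)) =
      involution_sum n (\<lambda>m. g (Suc (Suc m))) + n * involution_sum (n - 1) (\<lambda>m. g (Suc (Suc m)))"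
    by (cases n) simp_all
  show ?case
    unfolding involution_sum.simps split IH1 IH2 diff_Suc_1
    unfolding rec by (simp add: algebra_simps)
qed simp_all

section \<open>Standard Young tableaux\<close>

text \<open>The number of ways to empty a diagram of \<open>n\<close> cells by removing corners one by one. The size is
  an argument of its own so that the recursion is structural.\<close>
primrec num_SYT :: "nat \<Rightarrow> (nat \<times> nat) set \<Rightarrow> nat" where
  "num_SYT 0 D = of_bool (D = {})"
| "num_SYT (Suc n) D = (\<Sum>q\<in>removable D. num_SYT n (D - {q}))"

text \<open>In terms of the operators: removing a corner acts on powers of the operator that adds one like
  differentiation. The proof is the usual one for the Weyl algebra, moving the removal through one
  addition at a time.\<close>
lemma sum_num_SYT_addable:
  "young D \<Longrightarrow> (\<Sum>p\<in>addable D. num_SYT (Suc n) (insert p D)) = Suc n * num_SYT n D"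
proof (induction n arbitrary: D)
  case 0
  have "(\<Sum>p\<in>addable D. num_SYT (Suc 0) (insert p D)) = num_SYT 0 D +
      (\<Sum>q\<in>removable D. \<Sum>p\<in>addable (D - {q}). num_SYT 0 (insert p (D - {q})))"
    unfolding num_SYT.simps(2) by (rule sum_add_then_remove[OF 0])
  then show ?case by simp
next
  case (Suc n)
  have "(\<Sum>p\<in>addable D. num_SYT (Suc (Suc n)) (insert p D)) = num_SYT (Suc n) D +
      (\<Sum>q\<in>removable D. \<Sum>p\<in>addable (D - {q}). num_SYT (Suc n) (insert p (D - {q})))"
    unfolding num_SYT.simps(2)[of "Suc n"] by (rule sum_add_then_remove[OF Suc.prems])
  also have "\<dots> = num_SYT (Suc n) D + (\<Sum>q\<in>removable D. Suc n * num_SYT n (D - {q}))"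
    using Suc.IH by (simp only: young_minus_removable cong: sum.cong)
  also have "\<dots> = Suc (Suc n) * num_SYT (Suc n) D"
    by (simp add: sum_distrib_left sum.distrib)
  finally show ?case .
qed

text \<open>Both sides run over the pairs of diagrams that differ by one cell.\<close>
lemma sum_remove_eq_sum_add:
  fixes G :: "(nat \<times> nat) set \<Rightarrow> (nat \<times> nat) set \<Rightarrow> nat"
  shows "(\<Sum>E | young E \<and> card E = Suc n. \<Sum>q\<in>removable E. G (E - {q}) E) =
    (\<Sum>D | young D \<and> card D = n. \<Sum>p\<in>addable D. G D (insert p D))"
proof -
  let ?S = "SIGMA E:{E. young E \<and> card E = Suc n}. removable E"
  let ?S' = "SIGMA D:{D. young D \<and> card D = n}. addable D"
  have "(\<Sum>E | young E \<and> card E = Suc n. \<Sum>q\<in>removable E. G (E - {q}) E) =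
    (\<Sum>(E, q)\<in>?S. G (E - {q}) E)"
    by (subst sum.Sigma) (auto simp: finite_young_card finite_removable)
  also have "\<dots> = (\<Sum>(D, p)\<in>?S'. G D (insert p D))"
    by (rule sum.reindex_bij_witness[of _ "\<lambda>(D, p). (insert p D, p)" "\<lambda>(E, q). (E - {q}, q)"])
      (auto simp: addable_def removable_def insert_absorb young_finite)
  also have "\<dots> = (\<Sum>D | young D \<and> card D = n. \<Sum>p\<in>addable D. G D (insert p D))"
    by (subst sum.Sigma) (auto simp: finite_young_card finite_card_addable)
  finally show ?thesis .
qed

text \<open>The recurrence \<open>I(n+2) = I(n+1) + (n+1) I(n)\<close> without the Robinson-Schensted correspondence: a
  tableau with \<open>n + 2\<close> cells arises from one with \<open>n + 1\<close> cells by adding a corner, and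
  there is one more such corner than there are removable ones. Removing corners is then
  evaluated by \<open>sum_num_SYT_addable\<close>.\<close>
lemma sum_num_SYT:
  "(\<Sum>D | young D \<and> card D = n. num_SYT n D) = involution_sum n (\<lambda>_. 1)"
proof (induction n rule: induct_nat_012)
  case 0
  have "{D. young D \<and> card D = 0} = {{}}"
    by (auto simp: young_def)
  then show ?case by simp
next
  case 1
  have zero: "{D. young D \<and> card D = 0} = {{}}"
    by (auto simp: young_def)
  have "young {}" by (simp add: young_def)
  have "(\<Sum>D | young D \<and> card D = Suc 0. num_SYT (Suc 0) D) =
    (\<Sum>D | young D \<and> card D = 0. \<Sum>p\<in>addable D. num_SYT 0 D)"
    unfolding num_SYT.simps(2) by (rule sum_remove_eq_sum_add)
  also have "\<dots> = 1"
    using finite_card_addable(2)[OF \<open>young {}\<close>] by (simp add: zero removable_def)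
  finally show ?case by simp
next
  case (ge2 n)
  have "(\<Sum>D | young D \<and> card D = Suc (Suc n). num_SYT (Suc (Suc n)) D) =
    (\<Sum>D | young D \<and> card D = Suc n. \<Sum>p\<in>addable D. num_SYT (Suc n) D)"
    unfolding num_SYT.simps(2)[of "Suc n"] by (rule sum_remove_eq_sum_add)
  also have "\<dots> = (\<Sum>D | young D \<and> card D = Suc n.
      num_SYT (Suc n) D + (\<Sum>q\<in>removable D. num_SYT (Suc n) D))"
    by (rule sum.cong[OF refl]) (simp add: finite_card_addable(2) del: num_SYT.simps)
  also have "\<dots> = (\<Sum>D | young D \<and> card D = Suc n. num_SYT (Suc n) D) +
      (\<Sum>D | young D \<and> card D = n. \<Sum>p\<in>addable D. num_SYT (Suc n) (insert p D))"
    by (subst sum.distrib, subst sum_remove_eq_sum_add[symmetric]) (rule refl)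
  also have "(\<Sum>D | young D \<and> card D = n. \<Sum>p\<in>addable D. num_SYT (Suc n) (insert p D)) =
      Suc n * (\<Sum>D | young D \<and> card D = n. num_SYT n D)"
    unfolding sum_distrib_left
    by (rule sum.cong[OF refl]) (use sum_num_SYT_addable in blast)
  finally show ?case by (simp only: ge2 involution_sum.simps)
qed

section \<open>Limiting vacillating tableaux\<close>

lemma tableau_append_two:
  assumes "length T = 2 * k + 2"
  shows "limiting_vacillating_tableau (Suc k) \<mu> (T @ [\<rho>, \<mu>]) \<longleftrightarrow>
    (limiting_vacillating_tableau k (T ! (2 * k + 1)) T \<and> int_partition \<rho> \<and> int_partition \<mu> \<and>
     diagram (T ! (2 * k + 1)) \<subseteq> diagram \<rho> \<and> card (diagram \<rho> - diagram (T ! (2 * k + 1))) = 1 \<and>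
     diagram \<mu> \<subseteq> diagram \<rho> \<and> card (diagram \<rho> - diagram \<mu>) \<in> {0, 1})"
proof -
  let ?T = "T @ [\<rho>, \<mu>]"
  have old: "?T ! i = T ! i" if "i < 2 * k + 2" for i
    using that assms by (simp add: nth_append)
  have new: "?T ! (2 * k + 2) = \<rho>" "?T ! (2 * k + 3) = \<mu>"
    using assms by (simp_all add: nth_append)
  have down: "(\<forall>j \<le> Suc k. P (?T ! (2 * j)) (?T ! (2 * j + 1))) \<longleftrightarrow>
    (\<forall>j \<le> k. P (T ! (2 * j)) (T ! (2 * j + 1))) \<and> P \<rho> \<mu>" for P
    using new by (auto simp: le_Suc_eq old numeral_3_eq_3)
  have up: "(\<forall>j < Suc k. P (?T ! (2 * j + 1)) (?T ! (2 * j + 2))) \<longleftrightarrow>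
    (\<forall>j < k. P (T ! (2 * j + 1)) (T ! (2 * j + 2))) \<and> P (T ! (2 * k + 1)) \<rho>" for P
  proof -
    have "?T ! (2 * j + 1) = T ! (2 * j + 1)" "?T ! (2 * j + 2) = T ! (2 * j + 2)" if "j < k" for j
      by (rule old; use that in simp)+
    moreover have "?T ! (2 * k + 1) = T ! (2 * k + 1)" by (rule old) simp
    ultimately show ?thesis by (metis new(1) less_Suc_eq)
  qed
  have "?T ! (2 * Suc k + 1) = \<mu>" using new by (simp add: numeral_3_eq_3)
  moreover have "?T ! 0 = T ! 0" by (rule old) simp
  ultimately show ?thesis
    unfolding limiting_vacillating_tableau_def
      down[of "\<lambda>\<alpha> \<beta>. diagram \<beta> \<subseteq> diagram \<alpha> \<and> card (diagram \<alpha> - diagram \<beta>) \<in> {0, 1}"]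
      up[of "\<lambda>\<alpha> \<beta>. diagram \<alpha> \<subseteq> diagram \<beta> \<and> card (diagram \<beta> - diagram \<alpha>) = 1"]
    using assms by auto
qed

text \<open>Deleting the last two entries of a tableau of shape \<open>\<mu>\<close> leaves a shorter tableau of some shape
  \<open>\<nu>\<close>; the deleted middle entry is \<open>\<rho>\<close>.\<close>
lemma num_tableaux_of_shape_Suc:
  assumes "int_partition \<mu>"
  shows "num_tableaux_of_shape (Suc k) \<mu> =
    (\<Sum>\<rho> | int_partition \<rho> \<and> diagram \<mu> \<subseteq> diagram \<rho> \<and> card (diagram \<rho> - diagram \<mu>) \<in> {0, 1}.
     \<Sum>\<nu> | int_partition \<nu> \<and> diagram \<nu> \<subseteq> diagram \<rho> \<and> card (diagram \<rho> - diagram \<nu>) = 1.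
       num_tableaux_of_shape k \<nu>)"
proof -
  let ?V = "limiting_vacillating_tableau"
  let ?up = "{\<rho>. int_partition \<rho> \<and> diagram \<mu> \<subseteq> diagram \<rho> \<and> card (diagram \<rho> - diagram \<mu>) \<in> {0, 1}}"
  let ?down = "\<lambda>\<rho>. {\<nu>. int_partition \<nu> \<and> diagram \<nu> \<subseteq> diagram \<rho> \<and> card (diagram \<rho> - diagram \<nu>) = 1}"
  let ?S = "SIGMA \<rho>:?up. SIGMA \<nu>:?down \<rho>. {T. ?V k \<nu> T}"
  have len: "length T = 2 * k + 2" and last: "T ! (2 * k + 1) = \<nu>" and pp: "int_partition \<nu>"
    if "?V k \<nu> T" for \<nu> T
  proof -
    show "length T = 2 * k + 2" and "T ! (2 * k + 1) = \<nu>"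
      using that by (simp_all add: limiting_vacillating_tableau_def)
    then show "int_partition \<nu>"
      using that nth_mem[of "2 * k + 1" T] by (auto simp: limiting_vacillating_tableau_def)
  qed
  have "bij_betw (\<lambda>(\<rho>, \<nu>, T). T @ [\<rho>, \<mu>]) ?S {T. ?V (Suc k) \<mu> T}"
    unfolding bij_betw_def
  proof (intro conjI equalityI subsetI)
    show "inj_on (\<lambda>(\<rho>, \<nu>, T). T @ [\<rho>, \<mu>]) ?S"
      by (auto simp: inj_on_def dest: last)
    show "T \<in> {T. ?V (Suc k) \<mu> T}" if T: "T \<in> (\<lambda>(\<rho>, \<nu>, T). T @ [\<rho>, \<mu>]) ` ?S" for T
    proof -
      from T obtain \<rho> \<nu> T' where *: "T = T' @ [\<rho>, \<mu>]" "?V k \<nu> T'" "\<rho> \<in> ?up" "\<nu> \<in> ?down \<rho>"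
        by auto
      show ?thesis
        using * assms tableau_append_two[OF len[OF *(2)], of \<mu> \<rho>] last[OF *(2)] by simp
    qed
    show "T \<in> (\<lambda>(\<rho>, \<nu>, T). T @ [\<rho>, \<mu>]) ` ?S" if T: "T \<in> {T. ?V (Suc k) \<mu> T}" for T
    proof -
      define T' where "T' = take (2 * k + 2) T"
      from T have "length T = 2 * k + 4" and \<mu>: "T ! (2 * k + 3) = \<mu>"
        by (simp_all add: limiting_vacillating_tableau_def numeral_3_eq_3)
      then have len': "length T' = 2 * k + 2" by (simp add: T'_def)
      have "drop (2 * k + 2) T = [T ! (2 * k + 2), T ! (2 * k + 3)]"
        using \<open>length T = 2 * k + 4\<close> by (simp add: Cons_nth_drop_Suc[symmetric] numeral_3_eq_3)
      then have eq: "T = T' @ [T ! (2 * k + 2), \<mu>]"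
        unfolding T'_def \<mu>[symmetric] by (metis append_take_drop_id)
      have "?V (Suc k) \<mu> (T' @ [T ! (2 * k + 2), \<mu>])" using T eq by simp
      then have "(T ! (2 * k + 2), T' ! (2 * k + 1), T') \<in> ?S"
        unfolding tableau_append_two[OF len'] using pp by auto
      then show ?thesis by (rule rev_image_eqI) (simp only: prod.case, rule eq)
    qed
  qed
  then have "card {T. ?V (Suc k) \<mu> T} = card ?S" by (rule bij_betw_same_card[symmetric])
  also have "\<dots> = (\<Sum>\<rho>\<in>?up. \<Sum>\<nu>\<in>?down \<rho>. card {T. ?V k \<nu> T})"
  proof -
    have "finite {E. young E \<and> diagram \<mu> \<subseteq> E \<and> card (E - diagram \<mu>) \<in> {0, 1}}"
      unfolding diagrams_one_cell_larger_or_equal[OF young_diagram[OF assms]]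
      by (intro finite.insertI finite_imageI finite_card_addable(1) young_diagram assms)
    then have up: "finite ?up" by (rule finite_partitions_if_finite_diagrams)
    have down: "finite (?down \<rho>)" if "\<rho> \<in> ?up" for \<rho>
    proof (rule finite_partitions_if_finite_diagrams)
      have "young (diagram \<rho>)" using that young_diagram by blast
      then show "finite {E. young E \<and> E \<subseteq> diagram \<rho> \<and> card (diagram \<rho> - E) = 1}"
        unfolding diagrams_one_cell_smaller by (intro finite_imageI finite_removable)
    qed
    have "card ?S = (\<Sum>\<rho>\<in>?up. card (SIGMA \<nu>:?down \<rho>. {T. ?V k \<nu> T}))"
      by (rule card_SigmaI[OF up], intro ballI finite_SigmaI down)
        (assumption, rule finite_tableaux_of_shape)
    also have "\<dots> = (\<Sum>\<rho>\<in>?up. \<Sum>\<nu>\<in>?down \<rho>. card {T. ?V k \<nu> T})"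
      by (rule sum.cong[OF refl], rule card_SigmaI[OF down])
        (assumption, intro ballI finite_tableaux_of_shape)
    finally show ?thesis .
  qed
  finally show ?thesis by (simp only: num_tableaux_of_shape_def)
qed

text \<open>In the induction step, summing over \<open>\<nu>\<close> gives the value \<open>H\<close> of the larger diagram \<open>\<rho>\<close>,
  which is again a multiple of the number of its standard tableaux. The sum over \<open>\<rho>\<close> then contributes
  \<open>\<mu>\<close> itself and, by \<open>sum_num_SYT_addable\<close>, a factor \<open>|\<mu>| + 1\<close> for the diagrams above \<open>\<mu>\<close>; these
  are the two terms of the Stirling recurrence.\<close>
lemma num_tableaux_of_shape_eq:
  assumes "int_partition \<mu>"
  shows "num_tableaux_of_shape k \<mu> =
    Stirling (Suc k) (Suc (card (diagram \<mu>))) * num_SYT (card (diagram \<mu>)) (diagram \<mu>)"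
  using assms
proof (induction k arbitrary: \<mu>)
  case 0
  have empty: "diagram [] = {}" by (simp add: diagram_def)
  show ?case
  proof (cases "diagram \<mu> = {}")
    case True
    then have "\<mu> = []"
      using inj_onD[OF inj_on_diagram, of \<mu> "[]"] 0 by (simp add: empty int_partition_def)
    have "T = [[], []]" if "length T = 2" "T ! 0 = []" "T ! Suc 0 = []" for T :: "nat list list"
      using that by (auto simp: numeral_2_eq_2 length_Suc_conv)
    then have "{T. limiting_vacillating_tableau 0 \<mu> T} = {[[], []]}"
      unfolding \<open>\<mu> = []\<close> by (auto simp: limiting_vacillating_tableau_def int_partition_def)
    then show ?thesis by (simp add: num_tableaux_of_shape_def True)
  next
    case False
    then have "{T. limiting_vacillating_tableau 0 \<mu> T} = {}"
      by (auto simp: limiting_vacillating_tableau_def empty)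
    moreover have "0 < card (diagram \<mu>)" using False by (simp add: card_gt_0_iff)
    ultimately show ?thesis by (simp add: num_tableaux_of_shape_def)
  qed
next
  case (Suc k)
  define D where "D = diagram \<mu>"
  define n where "n = card D"
  define H where "H E = (\<Sum>q\<in>removable E.
    Stirling (Suc k) (Suc (card (E - {q}))) * num_SYT (card (E - {q})) (E - {q}))" for E
  have D: "young D" unfolding D_def by (rule young_diagram[OF Suc.prems])
  have H: "H E = Stirling (Suc k) (card E) * num_SYT (card E) E" if "young E" for E
  proof (cases "card E")
    case 0
    then have "removable E = {}" using young_finite[OF that] by (simp add: removable_def)
    then show ?thesis by (simp add: H_def 0)
  next
    case (Suc m)
    have "H E = (\<Sum>q\<in>removable E. Stirling (Suc k) (Suc m) * num_SYT m (E - {q}))"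
      unfolding H_def by (rule sum.cong) (auto simp: removable_def Suc)
    then show ?thesis by (simp add: Suc sum_distrib_left del: Stirling.simps)
  qed
  have down: "(\<Sum>\<nu> | int_partition \<nu> \<and> diagram \<nu> \<subseteq> diagram \<rho> \<and> card (diagram \<rho> - diagram \<nu>) = 1.
    num_tableaux_of_shape k \<nu>) = H (diagram \<rho>)" for \<rho>
  proof -
    have "(\<Sum>\<nu> | int_partition \<nu> \<and> diagram \<nu> \<subseteq> diagram \<rho> \<and> card (diagram \<rho> - diagram \<nu>) = 1.
        num_tableaux_of_shape k \<nu>) =
      (\<Sum>\<nu> | int_partition \<nu> \<and> diagram \<nu> \<subseteq> diagram \<rho> \<and> card (diagram \<rho> - diagram \<nu>) = 1.
        Stirling (Suc k) (Suc (card (diagram \<nu>))) * num_SYT (card (diagram \<nu>)) (diagram \<nu>))"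
      by (rule sum.cong[OF refl]) (use Suc.IH in blast)
    also have "\<dots> = (\<Sum>E | young E \<and> E \<subseteq> diagram \<rho> \<and> card (diagram \<rho> - E) = 1.
        Stirling (Suc k) (Suc (card E)) * num_SYT (card E) E)"
      by (rule sum_over_partitions)
    also have "\<dots> = H (diagram \<rho>)"
      unfolding diagrams_one_cell_smaller H_def
      by (subst sum.reindex) (auto simp: inj_on_def removable_def)
    finally show ?thesis .
  qed
  have "num_tableaux_of_shape (Suc k) \<mu> =
    (\<Sum>\<rho> | int_partition \<rho> \<and> D \<subseteq> diagram \<rho> \<and> card (diagram \<rho> - D) \<in> {0, 1}. H (diagram \<rho>))"
    unfolding num_tableaux_of_shape_Suc[OF Suc.prems] down D_def ..
  also have "\<dots> = (\<Sum>E | young E \<and> D \<subseteq> E \<and> card (E - D) \<in> {0, 1}. H E)"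
    by (rule sum_over_partitions)
  also have "\<dots> = H D + (\<Sum>p\<in>addable D. H (insert p D))"
  proof -
    have "inj_on (\<lambda>p. insert p D) (addable D)"
      unfolding addable_def inj_on_def by blast
    moreover have "D \<notin> (\<lambda>p. insert p D) ` addable D"
      unfolding addable_def by blast
    ultimately show ?thesis
      unfolding diagrams_one_cell_larger_or_equal[OF D]
      using finite_card_addable(1)[OF D] by (simp add: sum.reindex)
  qed
  also have "H D = Stirling (Suc k) n * num_SYT n D"
    unfolding n_def by (rule H[OF D])
  also have "(\<Sum>p\<in>addable D. H (insert p D)) =
      (\<Sum>p\<in>addable D. Stirling (Suc k) (Suc n) * num_SYT (Suc n) (insert p D))"
    by (rule sum.cong[OF refl])
      (simp add: H addable_def n_def young_finite[OF D] del: Stirling.simps num_SYT.simps)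
  also have "\<dots> = Stirling (Suc k) (Suc n) * (Suc n * num_SYT n D)"
    by (simp only: sum_distrib_left[symmetric] sum_num_SYT_addable[OF D])
  also have "Stirling (Suc k) n * num_SYT n D + \<dots> = Stirling (Suc (Suc k)) (Suc n) * num_SYT n D"
    unfolding Stirling.simps(4)[of "Suc k" n] by (simp add: algebra_simps del: Stirling.simps)
  finally show ?case by (simp only: n_def D_def)
qed

lemma num_tableaux_eq:
  "num_tableaux k = (\<Sum>n\<le>k. Stirling (Suc k) (Suc n) * involution_sum n (\<lambda>_. 1))"
proof -
  let ?F = "\<lambda>D. Stirling (Suc k) (Suc (card D)) * num_SYT (card D) D"
  have "finite {\<mu>. int_partition \<mu> \<and> card (diagram \<mu>) \<le> k}"
    unfolding card_diagram by (rule finite_bounded_int_partitions)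
  then have "num_tableaux k =
    (\<Sum>\<mu> | int_partition \<mu> \<and> card (diagram \<mu>) \<le> k. num_tableaux_of_shape k \<mu>)"
    unfolding num_tableaux_def
  proof (rule sum.mono_neutral_left)
    show "{\<mu>. int_partition \<mu> \<and> num_tableaux_of_shape k \<mu> \<noteq> 0}
      \<subseteq> {\<mu>. int_partition \<mu> \<and> card (diagram \<mu>) \<le> k}"
    proof safe
      fix \<mu> assume "int_partition \<mu>" "0 < num_tableaux_of_shape k \<mu>"
      then have "Stirling (Suc k) (Suc (card (diagram \<mu>))) \<noteq> 0"
        by (simp add: num_tableaux_of_shape_eq del: Stirling.simps)
      then show "card (diagram \<mu>) \<le> k"
        by (rule contrapos_np) (rule Stirling_less, simp)
    qed
  qed auto
  also have "\<dots> = (\<Sum>\<mu> | int_partition \<mu> \<and> card (diagram \<mu>) \<le> k. ?F (diagram \<mu>))"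
    by (rule sum.cong[OF refl]) (use num_tableaux_of_shape_eq in blast)
  also have "\<dots> = (\<Sum>D | young D \<and> card D \<le> k. ?F D)"
    by (rule sum_over_partitions)
  also have "\<dots> = (\<Sum>n\<le>k. \<Sum>D \<in> {D \<in> {D. young D \<and> card D \<le> k}. card D = n}. ?F D)"
  proof (rule sum.group[symmetric])
    have "{D. young D \<and> card D \<le> k} = (\<Union>n\<le>k. {D. young D \<and> card D = n})" by auto
    then show "finite {D. young D \<and> card D \<le> k}" by (simp add: finite_young_card)
  qed auto
  also have "\<dots> = (\<Sum>n\<le>k. Stirling (Suc k) (Suc n) * involution_sum n (\<lambda>_. 1))"
  proof (rule sum.cong[OF refl])
    fix n assume "n \<in> {..k}"
    then have "{D \<in> {D. young D \<and> card D \<le> k}. card D = n} = {D. young D \<and> card D = n}" by auto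
    moreover have "(\<Sum>D | young D \<and> card D = n. ?F D) =
        (\<Sum>D | young D \<and> card D = n. Stirling (Suc k) (Suc n) * num_SYT n D)"
      by (rule sum.cong) auto
    ultimately show "(\<Sum>D \<in> {D \<in> {D. young D \<and> card D \<le> k}. card D = n}. ?F D) =
        Stirling (Suc k) (Suc n) * involution_sum n (\<lambda>_. 1)"
      by (simp only: sum_distrib_left[symmetric] sum_num_SYT)
  qed
  finally show ?thesis .
qed

section \<open>Set partitions that are closed under negation\<close>

text \<open>A constant of its own for the image under negation, as opposed to an abbreviation, keeps its
  equations such as \<open>neg X = X\<close> from being unfolded into statements about elements.\<close>
definition neg :: "int set \<Rightarrow> int set" where
  "neg X = uminus ` X"

lemma mem_neg_iff [simp]: "x \<in> neg X \<longleftrightarrow> - x \<in> X"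
  unfolding neg_def by force

lemma neg_neg [simp]: "neg (neg X) = X"
  by auto

lemma neg_eq_neg_iff [simp]: "neg X = neg Y \<longleftrightarrow> X = Y"
  by (metis neg_neg)

lemma neg_empty [simp]: "neg {} = {}"
  by auto

lemma neg_eq_empty_iff [simp]: "neg X = {} \<longleftrightarrow> X = {}"
  unfolding neg_def by simp

lemma neg_insert [simp]: "neg (insert x X) = insert (- x) (neg X)"
  by auto

lemma neg_Diff [simp]: "neg (X - Y) = neg X - neg Y"
  by auto

text \<open>Type \<open>B\<close> set partitions of an arbitrary ground set, so that two opposite elements can be
  inserted.\<close>
definition signed_partition_on :: "int set \<Rightarrow> int set set \<Rightarrow> bool" where
  "signed_partition_on A P \<longleftrightarrow> partition_on A P \<and> (\<forall>X \<in> P. neg X \<in> P) \<and>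
     (\<forall>X \<in> P. \<forall>Y \<in> P. neg X = X \<and> neg Y = Y \<longrightarrow> X = Y)"

lemma type_B_set_partition_iff:
  "type_B_set_partition k P \<longleftrightarrow> signed_partition_on ({- int k..-1} \<union> {1..int k}) P"
  by (simp add: type_B_set_partition_def signed_partition_on_def neg_def)

definition nonzero_blocks :: "int set set \<Rightarrow> int set set" where
  "nonzero_blocks P = {X \<in> P. neg X \<noteq> X}"

text \<open>The union makes this the empty set if there is no zero-block.\<close>
definition zero_block :: "int set set \<Rightarrow> int set" where
  "zero_block P = \<Union> {X \<in> P. neg X = X}"

lemma signed_partition_on_blockD:
  assumes "signed_partition_on A P" "X \<in> P" "Y \<in> P"
  shows "neg X \<in> P" "X \<subseteq> A" "X \<noteq> {}" "x \<in> X \<Longrightarrow> x \<in> Y \<Longrightarrow> X = Y"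
    "neg X = X \<Longrightarrow> neg Y = Y \<Longrightarrow> X = Y"
proof -
  have P: "\<Union> P = A" "disjoint P" "{} \<notin> P" and neg: "\<forall>X\<in>P. neg X \<in> P"
    and zero: "\<forall>X\<in>P. \<forall>Y\<in>P. neg X = X \<and> neg Y = Y \<longrightarrow> X = Y"
    using assms(1) unfolding signed_partition_on_def partition_on_def by - (elim conjE; assumption)+
  show "neg X \<in> P" using neg assms(2) by (rule bspec)
  show "X \<subseteq> A" "X \<noteq> {}" using P(1,3) assms(2) by blast+
  show "x \<in> X \<Longrightarrow> x \<in> Y \<Longrightarrow> X = Y" using P(2) assms(2,3) unfolding disjoint_def by blast
  show "neg X = X \<Longrightarrow> neg Y = Y \<Longrightarrow> X = Y"
    using bspec[OF bspec[OF zero assms(2)] assms(3)] by (elim mp) (rule conjI)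
qed

lemma signed_partition_onI:
  assumes "\<Union> P = A" "\<And>X. X \<in> P \<Longrightarrow> neg X \<in> P" "\<And>X. X \<in> P \<Longrightarrow> X \<noteq> {}"
    and "\<And>X Y x. X \<in> P \<Longrightarrow> Y \<in> P \<Longrightarrow> x \<in> X \<Longrightarrow> x \<in> Y \<Longrightarrow> X = Y"
    and "\<And>X Y. X \<in> P \<Longrightarrow> Y \<in> P \<Longrightarrow> neg X = X \<Longrightarrow> neg Y = Y \<Longrightarrow> X = Y"
  shows "signed_partition_on A P"
proof -
  have "disjoint P"
    unfolding disjoint_def using assms(4) by blast
  moreover have "{} \<notin> P" using assms(3) by blast
  ultimately show ?thesis
    unfolding signed_partition_on_def partition_on_def
  proof (intro conjI ballI impI)
    show "X = Y" if "X \<in> P" "Y \<in> P" "neg X = X \<and> neg Y = Y" for X Y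
      using assms(5)[OF that(1,2)] that(3) by (elim conjE)
  qed (use assms(1,2) in blast)+
qed

text \<open>This lemma splits off a block \<open>Y\<close> together with its opposite, and the next one adds such a pair.
  They reduce the insertion and deletion of elements to an exchange of one pair of blocks.\<close>
lemma signed_partition_on_removeD:
  assumes P: "signed_partition_on A P" and Y: "Y \<in> P"
  shows "signed_partition_on (A - Y - neg Y) (P - {Y, neg Y})"
    and "neg Y = Y \<or> Y \<inter> neg Y = {}"
    and "neg Y = Y \<Longrightarrow> Z \<in> P - {Y, neg Y} \<Longrightarrow> neg Z \<noteq> Z"
proof -
  note D = signed_partition_on_blockD[OF P]
  have "\<Union> (P - {Y, neg Y}) = A - Y - neg Y"
  proof (intro equalityI subsetI)
    fix a assume "a \<in> A - Y - neg Y"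
    then show "a \<in> \<Union> (P - {Y, neg Y})"
      using P unfolding signed_partition_on_def partition_on_def by blast
  next
    fix a assume "a \<in> \<Union> (P - {Y, neg Y})"
    then obtain Z where "Z \<in> P" "Z \<noteq> Y" "Z \<noteq> neg Y" "a \<in> Z" by blast
    then show "a \<in> A - Y - neg Y"
      using D(2)[of Z Z] D(4)[of Z Y a] D(4)[of Z "neg Y" a] D(1)[OF Y Y] Y by blast
  qed
  moreover have "neg Z \<in> P - {Y, neg Y}" if "Z \<in> P - {Y, neg Y}" for Z
  proof -
    have "neg Z \<noteq> Y" "neg Z \<noteq> neg Y"
      using that neg_neg[of Z] by auto
    then show ?thesis using that D(1)[of Z Z] by blast
  qed
  ultimately show "signed_partition_on (A - Y - neg Y) (P - {Y, neg Y})"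
  proof (rule signed_partition_onI)
    show "S \<noteq> {}" if "S \<in> P - {Y, neg Y}" for S
      using D(3)[of S S] that by blast
    show "S = T" if "S \<in> P - {Y, neg Y}" "T \<in> P - {Y, neg Y}" "a \<in> S" "a \<in> T" for S T a
      using D(4)[of S T a] that by simp
    show "S = T" if "S \<in> P - {Y, neg Y}" "T \<in> P - {Y, neg Y}"
      "neg S = S" "neg T = T" for S T
      by (rule D(5)[OF _ _ that(3,4)]) (use that in simp_all)
  qed
  show "neg Y = Y \<or> Y \<inter> neg Y = {}"
    using D(4)[OF Y D(1)[OF Y Y]] by auto
  show "neg Z \<noteq> Z" if "neg Y = Y" "Z \<in> P - {Y, neg Y}"
    using D(5)[OF Y, of Z] that by auto
qed

lemma signed_partition_on_addI:
  assumes R: "signed_partition_on B R"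
    and Y: "Y \<noteq> {}" "(Y \<union> neg Y) \<inter> B = {}" "neg Y = Y \<or> Y \<inter> neg Y = {}"
    and zero: "neg Y = Y \<Longrightarrow> \<forall>Z\<in>R. neg Z \<noteq> Z"
  shows "signed_partition_on (B \<union> Y \<union> neg Y) (R \<union> {Y, neg Y})"
proof -
  have part: "\<Union> R = B"
    using R unfolding signed_partition_on_def partition_on_def by blast
  note D = signed_partition_on_blockD[OF R]
  have out: "Z \<inter> Y = {}" "Z \<inter> neg Y = {}" if "Z \<in> R" for Z
    using D(2)[OF that that] Y(2) by blast+
  show ?thesis
  proof (rule signed_partition_onI)
    show "\<Union> (R \<union> {Y, neg Y}) = B \<union> Y \<union> neg Y"
      using part by blast
    fix S assume S: "S \<in> R \<union> {Y, neg Y}"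
    then show "S \<noteq> {}" using D(3)[of S S] Y(1) neg_eq_empty_iff[of Y] by blast
    show "neg S \<in> R \<union> {Y, neg Y}" using S D(1)[of S S] by auto
    fix T assume T: "T \<in> R \<union> {Y, neg Y}"
    show "S = T" if "a \<in> S" "a \<in> T" for a
    proof (cases "S \<in> R")
      case True
      then have "a \<notin> Y" "a \<notin> neg Y" using out[of S] that by blast+
      then have "T \<in> R" using T that by blast
      then show ?thesis using D(4)[of S T a] True that by blast
    next
      case False
      then have "a \<in> Y \<union> neg Y" using S that by blast
      then have "T \<notin> R" using out[of T] that by blast
      then show ?thesis using S T False Y(3) that by auto
    qed
    show "S = T" if self: "neg S = S" "neg T = T"
    proof (cases "neg Y = Y")
      case True
      then have "S \<notin> R" "T \<notin> R" using zero self by blast+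
      then show ?thesis using True S T by simp
    next
      case False
      then have "neg (neg Y) \<noteq> neg Y" by simp
      with False have "S \<in> R" "T \<in> R" using S T self by blast+
      then show ?thesis using self by (rule D(5))
    qed
  qed
qed

lemma signed_partition_on_finite:
  assumes "signed_partition_on A P" "finite A"
  shows "finite P"
  using assms finite_elements unfolding signed_partition_on_def by blast

lemma zero_block_cases:
  assumes "signed_partition_on A P"
  obtains "zero_block P = {}" "\<And>X. X \<in> P \<Longrightarrow> neg X \<noteq> X"
  | "zero_block P \<in> P" "neg (zero_block P) = zero_block P"
proof (cases "\<exists>X\<in>P. neg X = X")
  case True
  then obtain X where X: "X \<in> P" "neg X = X" by blast
  then have "{X \<in> P. neg X = X} = {X}"
    using signed_partition_on_blockD(5)[OF assms] by (auto intro!: set_eqI)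
  then have "zero_block P = X" unfolding zero_block_def by (metis cSup_singleton)
  then show thesis using X that(2) by simp
next
  case False
  then have "{X \<in> P. neg X = X} = {}" by blast
  then have "zero_block P = {}" unfolding zero_block_def by (metis Union_empty)
  then show thesis using False that(1) by blast
qed

lemma zero_block_eqI:
  assumes P: "signed_partition_on A P" and X: "X \<in> P" "neg X = X"
  shows "zero_block P = X"
  using P
proof (cases rule: zero_block_cases)
  case 1
  then show ?thesis using X by simp
next
  case 2
  then show ?thesis using signed_partition_on_blockD(5)[OF P 2(1) X(1) 2(2) X(2)] by simp
qed

lemma zero_block_eq_empty: "(\<And>X. X \<in> P \<Longrightarrow> neg X \<noteq> X) \<Longrightarrow> zero_block P = {}"
  unfolding zero_block_def by blast

section \<open>Inserting a pair of opposite elements\<close>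

text \<open>The possible blocks of \<open>x\<close> after \<open>x\<close> and \<open>-x\<close> have been inserted into \<open>Q\<close>: a
  singleton, a nonzero block of \<open>Q\<close> with \<open>x\<close>, or the zero-block with both \<open>x\<close> and \<open>-x\<close>. If \<open>Q\<close> has
  no zero-block, the last choice creates \<open>{x, -x}\<close>.\<close>
definition new_blocks :: "int \<Rightarrow> int set set \<Rightarrow> int set set" where
  "new_blocks x Q = insert {x} (insert x ` nonzero_blocks Q) \<union> {insert x (insert (- x) (zero_block Q))}"

text \<open>Here \<open>Y\<close> is the block that \<open>x\<close> is to have. What \<open>Y\<close> contains besides \<open>x\<close> and \<open>-x\<close> is a block of
  \<open>Q\<close> or empty; it is exchanged, together with its opposite, for \<open>Y\<close> and the opposite of \<open>Y\<close>.\<close>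
definition extend_by :: "int \<Rightarrow> int set set \<Rightarrow> int set \<Rightarrow> int set set" where
  "extend_by x Q Y = (Q - {Y - {x, - x}, neg (Y - {x, - x})}) \<union> {Y, neg Y}"

definition delete_from :: "int \<Rightarrow> int set set \<Rightarrow> int set set" where
  "delete_from x P = (\<lambda>X. X - {x, - x}) ` P - {{}}"

definition block_of :: "int \<Rightarrow> int set set \<Rightarrow> int set" where
  "block_of x P = \<Union> {X \<in> P. x \<in> X}"

lemma block_of_eqI:
  assumes "signed_partition_on A P" "X \<in> P" "x \<in> X"
  shows "block_of x P = X"
proof -
  have "{Y \<in> P. x \<in> Y} = {X}"
    using assms signed_partition_on_blockD(4)[OF assms(1)] by auto
  then show ?thesis by (simp add: block_of_def)
qed

lemma new_blocksE:
  assumes Q: "signed_partition_on A Q" and x: "x \<notin> A" "- x \<notin> A" "x \<noteq> 0"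
    and Y: "Y \<in> new_blocks x Q"
  obtains "Y = {x}" "Y - {x, - x} = {}"
  | X where "Y = insert x X" "Y - {x, - x} = X" "X \<in> Q" "neg X \<noteq> X"
  | "Y = {x, - x}" "Y - {x, - x} = {}" "\<And>Z. Z \<in> Q \<Longrightarrow> neg Z \<noteq> Z"
  | X where "Y = insert x (insert (- x) X)" "Y - {x, - x} = X" "X \<in> Q" "neg X = X"
proof -
  have off: "Z - {x, - x} = Z" "insert x Z - {x, - x} = Z"
    "insert x (insert (- x) Z) - {x, - x} = Z" if "Z \<in> Q" for Z
    using signed_partition_on_blockD(2)[OF Q that that] x by auto
  from Y consider "Y = {x}" | X where "X \<in> nonzero_blocks Q" "Y = insert x X"
    | "Y = insert x (insert (- x) (zero_block Q))"
    unfolding new_blocks_def by blast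
  then show thesis
  proof cases
    case 1
    then show thesis using that(1) by simp
  next
    case 2
    then show thesis using that(2)[of X] off by (simp add: nonzero_blocks_def)
  next
    case 3
    from zero_block_cases[OF Q] show thesis
      by cases (use 3 that(3) that(4)[of "zero_block Q"] off in auto)
  qed
qed

text \<open>What the construction needs to know about the block \<open>Y\<close>, in a form in which the kinds of new blocks
  need no further distinction.\<close>
lemma new_blocks_properties:
  assumes Q: "signed_partition_on A Q" and x: "x \<notin> A" "- x \<notin> A" "x \<noteq> 0"
    and Y: "Y \<in> new_blocks x Q"
  defines "X \<equiv> Y - {x, - x}"
  shows "x \<in> Y" "X = {} \<or> X \<in> Q" "neg Y = Y \<or> Y \<inter> neg Y = {}"
    and "neg Y = Y \<Longrightarrow> Z \<in> Q - {X, neg X} \<Longrightarrow> neg Z \<noteq> Z"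
    and "neg Y = Y \<longleftrightarrow> - x \<in> Y" "X \<noteq> {} \<Longrightarrow> neg X = X \<longleftrightarrow> neg Y = Y"
proof -
  have off: "x \<notin> Z" "- x \<notin> Z" "x \<notin> neg Z" "- x \<notin> neg Z" if "Z \<in> Q" for Z
    using signed_partition_on_blockD(2)[OF Q that that]
      signed_partition_on_blockD(2)[OF Q signed_partition_on_blockD(1)[OF Q that that] that] x
    by blast+
  have "x \<in> Y \<and> (X = {} \<or> X \<in> Q) \<and> (neg Y = Y \<or> Y \<inter> neg Y = {}) \<and>
    (neg Y = Y \<longrightarrow> (\<forall>Z \<in> Q - {X, neg X}. neg Z \<noteq> Z)) \<and> (neg Y = Y \<longleftrightarrow> - x \<in> Y) \<and>
    (X \<noteq> {} \<longrightarrow> (neg X = X \<longleftrightarrow> neg Y = Y))"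
    using Q x Y
  proof (cases rule: new_blocksE)
    case 1
    then show ?thesis using x(3) unfolding X_def by auto
  next
    case (2 X')
    note o = off[OF 2(3)]
    have "neg Y = insert (- x) (neg X')" using 2(1) by simp
    moreover have "X' \<inter> neg X' = {}"
      using signed_partition_on_removeD(2)[OF Q 2(3)] 2(4) by simp
    ultimately have "Y \<inter> neg Y = {}" "x \<notin> neg Y" "- x \<notin> Y" "x \<in> Y" using 2(1) o x(3) by auto
    moreover from this have "neg Y \<noteq> Y" by metis
    ultimately show ?thesis using 2 unfolding X_def by simp
  next
    case 3
    have "neg Y = Y" using 3(1) by auto
    moreover have "\<forall>Z \<in> Q - {X, neg X}. neg Z \<noteq> Z" using 3(3) by blast
    ultimately show ?thesis using 3(1,2) unfolding X_def by simp
  next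
    case (4 X')
    have "neg Y = Y" unfolding 4(1) using 4(4) by (simp add: insert_commute)
    moreover have "\<forall>Z \<in> Q - {X, neg X}. neg Z \<noteq> Z"
      using signed_partition_on_removeD(3)[OF Q 4(3,4)] unfolding X_def 4(2) by blast
    moreover have "X = X'" "x \<in> Y" "- x \<in> Y" using 4(1,2) by (simp_all add: X_def)
    ultimately show ?thesis using 4(3,4) by simp
  qed
  then show "x \<in> Y" "X = {} \<or> X \<in> Q" "neg Y = Y \<or> Y \<inter> neg Y = {}"
    and "neg Y = Y \<Longrightarrow> Z \<in> Q - {X, neg X} \<Longrightarrow> neg Z \<noteq> Z"
    and "neg Y = Y \<longleftrightarrow> - x \<in> Y" "X \<noteq> {} \<Longrightarrow> neg X = X \<longleftrightarrow> neg Y = Y"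
    by - (elim conjE, simp)+
qed

lemma extend_by_correct:
  assumes Q: "signed_partition_on A Q" and x: "x \<notin> A" "- x \<notin> A" "x \<noteq> 0"
    and Y: "Y \<in> new_blocks x Q"
  shows "signed_partition_on (A \<union> {x, - x}) (extend_by x Q Y)"
    and "block_of x (extend_by x Q Y) = Y"
    and "delete_from x (extend_by x Q Y) = Q"
proof -
  define X where "X = Y - {x, - x}"
  define R where "R = Q - {X, neg X}"
  note props = new_blocks_properties[OF Q x Y, folded X_def]
  have ext: "extend_by x Q Y = R \<union> {Y, neg Y}"
    by (simp add: extend_by_def R_def X_def)
  have XA: "X \<subseteq> A" "neg X \<subseteq> A" "X \<noteq> {} \<Longrightarrow> neg X \<in> Q"
    using props(2) signed_partition_on_blockD(1,2)[OF Q] by (metis empty_subsetI neg_empty)+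
  have R: "signed_partition_on (A - X - neg X) R"
  proof (cases "X = {}")
    case True
    then have "R = Q" using signed_partition_on_blockD(3)[OF Q] by (auto simp: R_def)
    then show ?thesis using Q True by simp
  next
    case False
    then show ?thesis unfolding R_def using props(2) by (intro signed_partition_on_removeD(1)[OF Q]) simp
  qed
  have Y_cases: "Y = insert x X \<or> Y = insert x (insert (- x) X)"
    using props(1) by (auto simp: X_def)
  then have negY: "neg Y = insert (- x) (neg X) \<or> neg Y = insert (- x) (insert x (neg X))"
    by auto
  have "signed_partition_on (A - X - neg X \<union> Y \<union> neg Y) (R \<union> {Y, neg Y})"
  proof (rule signed_partition_on_addI[OF R])
    show "Y \<noteq> {}" using props(1) by blast
    show "(Y \<union> neg Y) \<inter> (A - X - neg X) = {}"
      using Y_cases negY x(1,2) by auto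
    show "neg Y = Y \<or> Y \<inter> neg Y = {}" by (rule props(3))
    show "\<forall>Z\<in>R. neg Z \<noteq> Z" if "neg Y = Y"
      using props(4)[OF that] unfolding R_def by (intro ballI)
  qed
  moreover have "A - X - neg X \<union> Y \<union> neg Y = A \<union> {x, - x}"
    using Y_cases negY XA by auto
  ultimately show sp: "signed_partition_on (A \<union> {x, - x}) (extend_by x Q Y)"
    by (simp add: ext)
  show "block_of x (extend_by x Q Y) = Y"
    by (rule block_of_eqI[OF sp _ props(1)]) (simp add: ext)
  have "Z - {x, - x} = Z" if "Z \<in> R" for Z
    using signed_partition_on_blockD(2)[OF R that that] x by blast
  then have "(\<lambda>Z. Z - {x, - x}) ` R = R" by simp
  moreover have "Y - {x, - x} = X" "neg Y - {x, - x} = neg X"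
    by (auto simp: X_def)
  moreover have "{} \<notin> R" using signed_partition_on_blockD(3)[OF R] by blast
  ultimately have "delete_from x (extend_by x Q Y) = R \<union> ({X, neg X} - {{}})"
    unfolding delete_from_def ext by auto
  also have "\<dots> = Q"
  proof (cases "X = {}")
    case True
    then show ?thesis using signed_partition_on_blockD(3)[OF Q] by (auto simp: R_def)
  next
    case False
    moreover from this have "X \<in> Q" using props(2) by simp
    ultimately have "{X, neg X} - {{}} = {X, neg X}" "{X, neg X} \<subseteq> Q" using XA(3) by auto
    then show ?thesis unfolding R_def by blast
  qed
  finally show "delete_from x (extend_by x Q Y) = Q" .
qed

text \<open>With \<open>extend_by_correct\<close>, this makes the partitions of \<open>A \<union> {x, -x}\<close> correspond bijectively to
  pairs of a partition of \<open>A\<close> and a new block for \<open>x\<close>.\<close>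
lemma delete_from_correct:
  assumes P: "signed_partition_on (A \<union> {x, - x}) P" and x: "x \<notin> A" "- x \<notin> A" "x \<noteq> 0"
  shows "signed_partition_on A (delete_from x P)"
    and "block_of x P \<in> new_blocks x (delete_from x P)"
    and "extend_by x (delete_from x P) (block_of x P) = P"
proof -
  have "\<Union> P = A \<union> {x, - x}"
    using P unfolding signed_partition_on_def partition_on_def by (elim conjE)
  then obtain Y where Y: "Y \<in> P" "x \<in> Y" by blast
  have block: "block_of x P = Y" by (rule block_of_eqI[OF P Y])
  define X where "X = Y - {x, - x}"
  define R where "R = P - {Y, neg Y}"
  have negX: "neg X = neg Y - {x, - x}" by (auto simp: X_def)
  note negY = signed_partition_on_blockD(1)[OF P Y(1) Y(1)]
  have PR: "P = R \<union> {Y, neg Y}" using Y negY by (auto simp: R_def)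
  have R: "signed_partition_on (A \<union> {x, - x} - Y - neg Y) R"
    unfolding R_def by (rule signed_partition_on_removeD(1)[OF P Y(1)])
  have Y_neg: "neg Y = Y \<or> Y \<inter> neg Y = {}"
    by (rule signed_partition_on_removeD(2)[OF P Y(1)])
  have R_nonzero: "neg Z \<noteq> Z" if "neg Y = Y" "Z \<in> R" for Z
    using signed_partition_on_removeD(3)[OF P Y(1) that(1)] that(2) unfolding R_def .
  have sub: "Y \<subseteq> A \<union> {x, - x}" "neg Y \<subseteq> A \<union> {x, - x}"
    using signed_partition_on_blockD(2)[OF P Y(1) Y(1)] signed_partition_on_blockD(2)[OF P negY negY]
    by simp_all
  have x_neg: "- x \<in> neg Y" using Y(2) by simp
  have off: "Z - {x, - x} = Z" if "Z \<in> R" for Z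
    using signed_partition_on_blockD(2)[OF R that that] Y(2) x_neg by blast
  have "{} \<notin> R" using signed_partition_on_blockD(3)[OF R] by blast
  then have del: "delete_from x P = R \<union> ({X, neg X} - {{}})"
    unfolding delete_from_def PR using off by (auto simp: negX X_def)
  have X_neg: "X \<noteq> {} \<Longrightarrow> neg X = X \<longleftrightarrow> neg Y = Y"
    using Y_neg negX by (auto simp: X_def)
  \<comment> \<open>The ground set that is left after the exchange is the same for \<open>P\<close> and for its restriction.\<close>
  have base: "A \<union> {x, - x} - Y - neg Y = A - X - neg X"
    using Y(2) x_neg x by (auto simp: negX X_def)
  show Q: "signed_partition_on A (delete_from x P)"
  proof (cases "X = {}")
    case True
    then show ?thesis using R unfolding base del by simp
  next
    case False
    have "signed_partition_on (A - X - neg X \<union> X \<union> neg X) (R \<union> {X, neg X})"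
    proof (rule signed_partition_on_addI)
      show "signed_partition_on (A - X - neg X) R" using R unfolding base .
      show "neg X = X \<or> X \<inter> neg X = {}" 
        using Y_neg unfolding negX X_def by auto
      show "\<forall>Z\<in>R. neg Z \<noteq> Z" if "neg X = X"
        using R_nonzero X_neg[OF False] that by simp
    qed (use False in auto)
    moreover have "A - X - neg X \<union> X \<union> neg X = A"
      using sub by (auto simp: negX X_def)
    moreover have "{X, neg X} - {{}} = {X, neg X}" using False by auto
    ultimately show ?thesis unfolding del by simp
  qed
  show "block_of x P \<in> new_blocks x (delete_from x P)"
  proof (cases "neg Y = Y")
    case True
    then have "- x \<in> Y" using x_neg by simp
    then have "Y = insert x (insert (- x) X)" using Y(2) by (auto simp: X_def)
    moreover have "zero_block (delete_from x P) = X"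
    proof (cases "X = {}")
      case empty: True
      then show ?thesis using R_nonzero[OF True] zero_block_eq_empty[of R] unfolding del by simp
    next
      case False
      then show ?thesis
        by (intro zero_block_eqI[OF Q]) (simp_all add: del X_neg True)
    qed
    ultimately show ?thesis unfolding block new_blocks_def by simp
  next
    case False
    then have "- x \<notin> Y" using Y_neg Y(2) x_neg by blast
    then have YX: "Y = insert x X" using Y(2) by (auto simp: X_def)
    show ?thesis
    proof (cases "X = {}")
      case True
      then show ?thesis using YX unfolding block new_blocks_def by simp
    next
      case X: False
      then have "X \<in> nonzero_blocks (delete_from x P)"
        using False X_neg by (simp add: nonzero_blocks_def del)
      then show ?thesis using YX unfolding block new_blocks_def by simp
    qed
  qed
  have "X \<notin> R" "neg X \<notin> R"
  proof -
    have "Z \<inter> X = {}" "Z \<inter> neg X = {}" if "Z \<in> R" for Z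
      using signed_partition_on_blockD(2)[OF R that that] unfolding base by blast+
    then show "X \<notin> R" "neg X \<notin> R" using \<open>{} \<notin> R\<close> by (metis inf.idem)+
  qed
  then have "delete_from x P - {X, neg X} = R" unfolding del by auto
  then show "extend_by x (delete_from x P) (block_of x P) = P"
    unfolding block extend_by_def X_def[symmetric] using PR by simp
qed

text \<open>Only a new singleton increases the number of nonzero blocks, by itself and its opposite. An enlarged
  nonzero block replaces an old one, and an enlarged zero-block remains a zero-block.\<close>
lemma card_nonzero_blocks_extend_by:
  assumes Q: "signed_partition_on A Q" and x: "x \<notin> A" "- x \<notin> A" "x \<noteq> 0"
    and Y: "Y \<in> new_blocks x Q" and fin: "finite A"
  shows "card (nonzero_blocks (extend_by x Q Y)) =
    card (nonzero_blocks Q) + (if Y = {x} then 2 else 0)"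
proof -
  define X where "X = Y - {x, - x}"
  define R where "R = Q - {X, neg X}"
  note props = new_blocks_properties[OF Q x Y, folded X_def]
  have finQ: "finite (nonzero_blocks Q)"
    using signed_partition_on_finite[OF Q fin] by (simp add: nonzero_blocks_def)
  have ext: "extend_by x Q Y = R \<union> {Y, neg Y}"
    by (simp add: extend_by_def R_def X_def)
  show ?thesis
  proof (cases "neg Y = Y")
    case True
    have "nonzero_blocks R = nonzero_blocks Q"
    proof (cases "X = {}")
      case True
      then show ?thesis by (auto simp: nonzero_blocks_def R_def)
    next
      case False
      then have "neg X = X" using props(6) True by simp
      then show ?thesis by (auto simp: nonzero_blocks_def R_def)
    qed
    moreover have "nonzero_blocks (extend_by x Q Y) = nonzero_blocks R"
      unfolding ext using True by (auto simp: nonzero_blocks_def)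
    moreover have "Y \<noteq> {x}" using props(5) True x(3) by auto
    ultimately show ?thesis by simp
  next
    case False
    have "nonzero_blocks (extend_by x Q Y) = nonzero_blocks R \<union> {Y, neg Y}"
      unfolding ext using False by (auto simp: nonzero_blocks_def)
    moreover have "Y \<notin> nonzero_blocks R" "neg Y \<notin> nonzero_blocks R"
    proof -
      have "- x \<in> neg Y" using props(1) by simp
      then have "Y \<notin> Q" "neg Y \<notin> Q"
        using signed_partition_on_blockD(2)[OF Q, of Y Y]
          signed_partition_on_blockD(2)[OF Q, of "neg Y" "neg Y"] props(1) x(1,2) by blast+
      then show "Y \<notin> nonzero_blocks R" "neg Y \<notin> nonzero_blocks R"
        by (simp_all add: nonzero_blocks_def R_def)
    qed
    moreover have nR: "nonzero_blocks R = nonzero_blocks Q - {X, neg X}"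
      by (auto simp: nonzero_blocks_def R_def)
    ultimately have c: "card (nonzero_blocks (extend_by x Q Y)) = card (nonzero_blocks Q - {X, neg X}) + 2"
      using False finQ by simp
    show ?thesis
    proof (cases "X = {}")
      case True
      then have "nonzero_blocks Q - {X, neg X} = nonzero_blocks Q" by (auto simp: nonzero_blocks_def)
      moreover have "Y = {x}"
        using True props(1,5) False unfolding X_def by auto
      ultimately show ?thesis using c by simp
    next
      case X: False
      then have "X \<in> Q" "neg X \<noteq> X" using props(2,6) False by simp_all
      moreover from this have "neg X \<in> Q" using signed_partition_on_blockD(1)[OF Q] by blast
      ultimately have "{X, neg X} \<subseteq> nonzero_blocks Q" by (auto simp: nonzero_blocks_def)
      then have "card (nonzero_blocks Q - {X, neg X}) + 2 = card (nonzero_blocks Q)"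
        using \<open>neg X \<noteq> X\<close>[symmetric] finQ card_mono[of "nonzero_blocks Q" "{X, neg X}"]
          card_Diff_subset[of "{X, neg X}" "nonzero_blocks Q"] by simp
      moreover have "Y \<noteq> {x}" using X unfolding X_def by auto
      ultimately show ?thesis using c by simp
    qed
  qed
qed

text \<open>The new blocks are counted according to the increase, \<open>2\<close> or \<open>0\<close>, in
  \<open>card_nonzero_blocks_extend_by\<close>.\<close>
lemma sum_new_blocks:
  fixes h :: "nat \<Rightarrow> nat"
  assumes Q: "signed_partition_on A Q" and x: "x \<notin> A" "- x \<notin> A" "x \<noteq> 0" and fin: "finite A"
  shows "finite (new_blocks x Q)"
    and "(\<Sum>Y\<in>new_blocks x Q. h (if Y = {x} then 2 else 0)) = h 2 + Suc (card (nonzero_blocks Q)) * h 0"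
proof -
  let ?Z = "insert x (insert (- x) (zero_block Q))"
  have finQ: "finite (nonzero_blocks Q)"
    using signed_partition_on_finite[OF Q fin] by (simp add: nonzero_blocks_def)
  then show "finite (new_blocks x Q)" by (simp add: new_blocks_def)
  have off: "x \<notin> X" "- x \<notin> X" "X \<noteq> {}" if "X \<in> nonzero_blocks Q" for X
    using that signed_partition_on_blockD(2,3)[OF Q, of X X] x by (auto simp: nonzero_blocks_def)
  have "inj_on (insert x) (nonzero_blocks Q)"
    by (rule inj_onI) (metis off(1) insert_ident)
  then have "card (insert x ` nonzero_blocks Q) = card (nonzero_blocks Q)" by (rule card_image)
  moreover have "?Z \<notin> insert x ` nonzero_blocks Q"
  proof
    assume "?Z \<in> insert x ` nonzero_blocks Q"
    then obtain X where "X \<in> nonzero_blocks Q" "?Z = insert x X" by blast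
    then have "- x \<in> insert x X" by blast
    then show False using off(2)[OF \<open>X \<in> nonzero_blocks Q\<close>] x(3) by simp
  qed
  ultimately have c: "card (insert ?Z (insert x ` nonzero_blocks Q)) = Suc (card (nonzero_blocks Q))"
    using finQ by simp
  have "- x \<in> ?Z" by simp
  then have "?Z \<noteq> {x}" using x(3) by (metis neg_equal_zero singletonD)
  moreover have "{x} \<notin> insert x ` nonzero_blocks Q"
    using off by fastforce
  ultimately have single: "{x} \<notin> insert ?Z (insert x ` nonzero_blocks Q)" by simp
  have "new_blocks x Q = insert {x} (insert ?Z (insert x ` nonzero_blocks Q))"
    by (auto simp: new_blocks_def)
  then have "(\<Sum>Y\<in>new_blocks x Q. h (if Y = {x} then 2 else 0)) =
    h 2 + (\<Sum>Y\<in>insert ?Z (insert x ` nonzero_blocks Q). h (if Y = {x} then 2 else 0))"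
    using finQ single by simp
  also have "(\<Sum>Y\<in>insert ?Z (insert x ` nonzero_blocks Q). h (if Y = {x} then 2 else 0)) =
    (\<Sum>Y\<in>insert ?Z (insert x ` nonzero_blocks Q). h 0)"
    by (rule sum.cong[OF refl]) (use single in metis)
  finally show "(\<Sum>Y\<in>new_blocks x Q. h (if Y = {x} then 2 else 0)) =
      h 2 + Suc (card (nonzero_blocks Q)) * h 0"
    using c by simp
qed

lemma finite_signed_partitions: "finite A \<Longrightarrow> finite {P. signed_partition_on A P}"
  by (rule finite_subset[of _ "Pow (Pow A)"]) (auto simp: signed_partition_on_def partition_on_def)

text \<open>The two terms belong to \<open>{x}\<close> as a new block and to all other new blocks of \<open>x\<close>: one
  for every nonzero block of \<open>Q\<close> and one for the zero-block.\<close>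
lemma sum_signed_partitions_insert:
  fixes g :: "nat \<Rightarrow> nat"
  assumes x: "x \<notin> A" "- x \<notin> A" "x \<noteq> 0" and fin: "finite A"
  shows "(\<Sum>P | signed_partition_on (A \<union> {x, - x}) P. g (card (nonzero_blocks P))) =
    (\<Sum>Q | signed_partition_on A Q.
       g (card (nonzero_blocks Q) + 2) + Suc (card (nonzero_blocks Q)) * g (card (nonzero_blocks Q)))"
proof -
  let ?S = "SIGMA Q:{Q. signed_partition_on A Q}. new_blocks x Q"
  have "(\<Sum>P | signed_partition_on (A \<union> {x, - x}) P. g (card (nonzero_blocks P))) =
    (\<Sum>(Q, Y)\<in>?S. g (card (nonzero_blocks Q) + (if Y = {x} then 2 else 0)))"
  proof (rule sum.reindex_bij_witness[of _ "\<lambda>(Q, Y). extend_by x Q Y" "\<lambda>P. (delete_from x P, block_of x P)"])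
    fix P assume "P \<in> {P. signed_partition_on (A \<union> {x, - x}) P}"
    then have P: "signed_partition_on (A \<union> {x, - x}) P" by simp
    note del = delete_from_correct[OF P x]
    show "(case (delete_from x P, block_of x P) of (Q, Y) \<Rightarrow> extend_by x Q Y) = P"
      using del(3) by simp
    show "(delete_from x P, block_of x P) \<in> ?S" using del(1,2) by simp
    show "(case (delete_from x P, block_of x P) of
        (Q, Y) \<Rightarrow> g (card (nonzero_blocks Q) + (if Y = {x} then 2 else 0))) = g (card (nonzero_blocks P))"
      using card_nonzero_blocks_extend_by[OF del(1) x del(2) fin] unfolding del(3) by simp
  next
    fix QY assume "QY \<in> ?S"
    then obtain Q Y where QY: "QY = (Q, Y)" "signed_partition_on A Q" "Y \<in> new_blocks x Q" by blast
    note ext = extend_by_correct[OF QY(2) x QY(3)]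
    show "(delete_from x (case QY of (Q, Y) \<Rightarrow> extend_by x Q Y),
        block_of x (case QY of (Q, Y) \<Rightarrow> extend_by x Q Y)) = QY"
      using ext(2,3) by (simp add: QY(1))
    show "(case QY of (Q, Y) \<Rightarrow> extend_by x Q Y) \<in> {P. signed_partition_on (A \<union> {x, - x}) P}"
      using ext(1) by (simp add: QY(1))
  qed
  also have "\<dots> = (\<Sum>Q | signed_partition_on A Q. \<Sum>Y\<in>new_blocks x Q.
      g (card (nonzero_blocks Q) + (if Y = {x} then 2 else 0)))"
    by (rule sum.Sigma[symmetric])
      (use finite_signed_partitions[OF fin] sum_new_blocks(1)[OF _ x fin] in auto)
  also have "\<dots> = (\<Sum>Q | signed_partition_on A Q.
      g (card (nonzero_blocks Q) + 2) + Suc (card (nonzero_blocks Q)) * g (card (nonzero_blocks Q)))"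
    using sum_new_blocks(2)[OF _ x fin, of _ "\<lambda>i. g (card (nonzero_blocks _) + i)"]
    by (intro sum.cong[OF refl]) (simp add: sum_new_blocks(2)[OF _ x fin])
  finally show ?thesis .
qed

section \<open>Counting type B set partitions\<close>

text \<open>The weight \<open>g\<close> stays arbitrary because the induction step changes it: by
  \<open>sum_signed_partitions_insert\<close>, the weight \<open>g\<close> for \<open>k + 1\<close> becomes \<open>g (q + 2) + (q + 1) * g q\<close>
  for \<open>k\<close>. With \<open>q = 2 m\<close>, \<open>involution_sum_double_cycles\<close> turns this into the recurrence of the
  Stirling numbers.\<close>
lemma sum_type_B_set_partitions:
  "(\<Sum>P | type_B_set_partition k P. g (card (nonzero_blocks P))) =
     (\<Sum>n\<le>k. Stirling (Suc k) (Suc n) * involution_sum n (\<lambda>m. g (2 * m)))"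
proof (induction k arbitrary: g)
  case 0
  have "{P. type_B_set_partition 0 P} = {{}}"
    by (auto simp: type_B_set_partition_def partition_on_empty)
  then show ?case by (simp add: nonzero_blocks_def)
next
  case (Suc k)
  let ?J = "\<lambda>n. involution_sum n (\<lambda>m. g (2 * m))"
  let ?S = "\<lambda>n. Stirling (Suc k) n"
  define A where "A = {- int k..-1} \<union> {1..int k}"
  define x where "x = int (Suc k)"
  have x: "x \<notin> A" "- x \<notin> A" "x \<noteq> 0" "finite A" by (auto simp: A_def x_def)
  have Ax: "{- int (Suc k)..-1} \<union> {1..int (Suc k)} = A \<union> {x, - x}"
    by (auto simp: A_def x_def)
  have step: "involution_sum n (\<lambda>m. g (2 * m + 2) + Suc (2 * m) * g (2 * m)) =
      ?J (Suc n) + Suc n * ?J n" for n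
  proof -
    have "involution_sum n (\<lambda>m. g (2 * m + 2) + Suc (2 * m) * g (2 * m)) =
      involution_sum n (\<lambda>m. g (2 * Suc m)) + (?J n + involution_sum n (\<lambda>m. 2 * m * g (2 * m)))"
      by (simp add: involution_sum_add[symmetric])
    also have "involution_sum n (\<lambda>m. 2 * m * g (2 * m)) =
      n * ?J n + n * involution_sum (n - 1) (\<lambda>m. g (2 * Suc m))"
      by (rule involution_sum_double_cycles)
    also have "involution_sum n (\<lambda>m. g (2 * Suc m)) + (?J n + \<dots>) = ?J (Suc n) + Suc n * ?J n"
      by (cases n) (simp_all add: numeral_2_eq_2)
    finally show ?thesis .
  qed
  have "(\<Sum>P | type_B_set_partition (Suc k) P. g (card (nonzero_blocks P))) =
    (\<Sum>Q | type_B_set_partition k Q. g (card (nonzero_blocks Q) + 2) +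
       Suc (card (nonzero_blocks Q)) * g (card (nonzero_blocks Q)))"
    unfolding type_B_set_partition_iff Ax A_def[symmetric] by (rule sum_signed_partitions_insert[OF x])
  also have "\<dots> = (\<Sum>n\<le>k. ?S (Suc n) * (?J (Suc n) + Suc n * ?J n))"
    unfolding Suc.IH[of "\<lambda>q. g (q + 2) + Suc q * g q"] step ..
  also have "\<dots> = (\<Sum>n\<le>k. ?S (Suc n) * ?J (Suc n)) + (\<Sum>n\<le>k. Suc n * ?S (Suc n) * ?J n)"
    by (simp only: distrib_left sum.distrib mult_ac)
  also have "(\<Sum>n\<le>k. ?S (Suc n) * ?J (Suc n)) = (\<Sum>n\<le>Suc k. ?S n * ?J n)"
    \<comment> \<open>The new term for \<open>n = 0\<close> vanishes, because \<open>Stirling (Suc k) 0 = 0\<close>.\<close>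
    unfolding sum.atMost_Suc_shift[of _ k] by simp
  also have "(\<Sum>n\<le>k. Suc n * ?S (Suc n) * ?J n) = (\<Sum>n\<le>Suc k. Suc n * ?S (Suc n) * ?J n)"
    \<comment> \<open>The new term for \<open>n = Suc k\<close> vanishes, because it lies above the diagonal.\<close>
    by (simp del: Stirling.simps)
  also have "(\<Sum>n\<le>Suc k. ?S n * ?J n) + \<dots> = (\<Sum>n\<le>Suc k. Stirling (Suc (Suc k)) (Suc n) * ?J n)"
    unfolding Stirling.simps(4)[of "Suc k"]
    by (simp only: sum.distrib[symmetric] add_mult_distrib add.commute)
  finally show ?case .
qed

theorem theorem24:
  fixes k :: nat
  assumes "k \<ge> 1"
  shows "num_tableaux k = card {P. type_B_set_partition k P}"
  using sum_type_B_set_partitions[of "\<lambda>_. 1" k] by (simp only: num_tableaux_eq card_eq_sum)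

end
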